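(* Let $k$ be a field of characteristic zero and let $\omega=f_1\,dx_1+\cdots+f_m\,dx_m$ be a closed $1$-form with $f_1,\dots,f_m\in k(t,x_1,\dots,x_m)$. The algorithm CTOneForm (described in the context), applied to $\omega$, terminates and returns a minimal telescoper $L\in k(t)\langle\partial_t\rangle$ for $\omega$ together with a certificate $g$ of $L$.
   Context: $\partial_i=\partial/\partial x_i$ and $\partial_t=\partial/\partial t$ are the usual commuting derivations of $k(t,x_1,\dots,x_m)$, extended uniquely to its algebraic closure. The exterior derivative $d$ is with respect to $x_1,\dots,x_m$ only: $dg=\sum_i\partial_i(g)\,dx_i$; $\omega$ is closed if $\partial_i(f_j)=\partial_j(f_i)$ for all $i,j$. $k(t)\langle\partial_t\rangle$ is the ring of linear differential operators in $\partial_t$ with coefficients in $k(t)$; operators act on $1$-forms coefficientwise: $L(\omega)=\sum_i L(f_i)\,dx_i$. An operator $L\in k(t)\langle\partial_t\rangle$ is a telescoper for $\omega$ if $L(\omega)=dg$ for some $g$ algebraic over $k(t,x_1,\dots,x_m)$; such a $g$ is a certificate of $L$. A minimal telescoper is a nonzero telescoper of minimal degree in $\partial_t$. A rational function in $k(t)(x_1,\dots,x_m)$ is proper in $x_i$ if it equals $a/b$ with $a,b\in k(t)[x_1,\dots,x_m]$ coprime and $\deg_{x_i}(a)<\deg_{x_i}(b)$ (with $\deg_{x_i}(0)=-\infty$). A closed $1$-form $\sum_i h_i\,dx_i$ with $h_i\in k(t)(x_1,\dots,x_m)$ is simple if each $h_i$ is proper in $x_i$ with denominator squarefree in $k(t)[x_1,\dots,x_m]$.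 HermiteOneForm denotes a procedure that, for a closed $1$-form $\eta$ with coefficients in $k(t)(x_1,\dots,x_m)$, returns $g\in k(t)(x_1,\dots,x_m)$ and a simple form $r$ with coefficients in $k(t)(x_1,\dots,x_m)$ such that $\eta=dg+r$ (such a decomposition always exists). Algorithm CTOneForm, input $\omega$: (1) Decompose $\omega=dg_0+r_0$ by HermiteOneForm. (2) Set $n:=0$ and $\mathcal{L}:=[r_0]$. (3) While the elements of $\mathcal{L}$ are linearly independent over $k(t)$: set $n:=n+1$, apply HermiteOneForm to $\partial_t(r_{n-1})$ to get $\partial_t(r_{n-1})=dg_n+r_n$, and append $r_n$ to $\mathcal{L}$. (4) Find a nontrivial linear relation $\sum_{i=0}^n a_i(t)\,r_i=0$ with $a_i(t)\in k(t)$. (5) Return $L=\sum_{i=0}^n a_i(t)\,\partial_t^i$ and $g=\sum_{i=0}^n a_i(t)\sum_{j=0}^i\partial_t^{\,i-j}(g_j)$. *)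

theory Defs
  imports
    "HOL-Library.Poly_Mapping"
    "HOL-Library.While_Combinator"
    "HOL-Computational_Algebra.Computational_Algebra"
    "HOL-Algebra.Algebraic_Closure_Type"
begin

section \<open>The fields $k(t)$ and $k(t)(x_1,\dots,x_m)$\<close>

text \<open>
  The variables $x_1,\dots,x_m$ are indexed by a finite linearly ordered type \<open>'v\<close>; the order
  is only needed because the library's integral-domain instance for \<open>('v \<Rightarrow>\<^sub>0 nat) \<Rightarrow>\<^sub>0 'a\<close>
  depends on one.  The field $k(t,x_1,\dots,x_m)$ is built as the fraction field of
  $k(t)[x_1,\dots,x_m]$.
\<close>

type_synonym 'k kt = "'k poly fract"
type_synonym ('k, 'v) kt_mpoly = "('v \<Rightarrow>\<^sub>0 nat) \<Rightarrow>\<^sub>0 'k kt"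
type_synonym ('k, 'v) ratfun = "('k, 'v) kt_mpoly fract"

definition of_kt :: "'k::field_char_0 kt \<Rightarrow> ('k, 'v::linorder) ratfun" where
  "of_kt c = Fract (Poly_Mapping.single 0 c) 1"


section \<open>Derivations\<close>

definition derivation :: "('a::comm_ring_1 \<Rightarrow> 'a) \<Rightarrow> bool" where
  "derivation D \<longleftrightarrow>
     (\<forall>x y. D (x + y) = D x + D y) \<and> (\<forall>x y. D (x * y) = D x * y + x * D y)"

text \<open>
  Quotient rule.  For a derivation \<open>d\<close> the value does not depend on the representation of
  the fraction; see \<open>fract_deriv_Fract\<close> below.
\<close>

definition fract_deriv :: "('a::idom \<Rightarrow> 'a) \<Rightarrow> 'a fract \<Rightarrow> 'a fract" where
  "fract_deriv d q =
     (THE r. \<forall>a b. b \<noteq> 0 \<and> q = Fract a b \<longrightarrow> r = Fract (d a * b - a * d b) (b * b))"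

definition D_t_mpoly :: "('k::field_char_0, 'v::linorder) kt_mpoly \<Rightarrow> ('k, 'v) kt_mpoly" where
  "D_t_mpoly p = Poly_Mapping.map (fract_deriv pderiv) p"

definition D_x_mpoly :: "'v::linorder \<Rightarrow> ('k::field_char_0, 'v) kt_mpoly \<Rightarrow> ('k, 'v) kt_mpoly" where
  "D_x_mpoly v p =
     (\<Sum>e\<in>Poly_Mapping.keys p.
        Poly_Mapping.single (e - Poly_Mapping.single v 1)
          (of_nat (Poly_Mapping.lookup e v) * Poly_Mapping.lookup p e))"

definition D_t :: "('k::field_char_0, 'v::linorder) ratfun \<Rightarrow> ('k, 'v) ratfun" where
  "D_t = fract_deriv D_t_mpoly"

definition D_x :: "'v::linorder \<Rightarrow> ('k::field_char_0, 'v) ratfun \<Rightarrow> ('k, 'v) ratfun" where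
  "D_x v = fract_deriv (D_x_mpoly v)"

text \<open>The extension of a derivation to the algebraic closure, unique in characteristic zero.\<close>

definition ac_deriv :: "('a::field \<Rightarrow> 'a) \<Rightarrow> 'a alg_closure \<Rightarrow> 'a alg_closure" where
  "ac_deriv D = (THE D'. derivation D' \<and> (\<forall>x. D' (to_ac x) = to_ac (D x)))"


section \<open>One-forms, operators and telescopers\<close>

text \<open>The form $\sum_v f_v\,dx_v$ is represented by its coefficient family \<open>f\<close>.\<close>

type_synonym ('k, 'v) one_form = "'v \<Rightarrow> ('k, 'v) ratfun"

definition closed_form :: "('k::field_char_0, 'v::linorder) one_form \<Rightarrow> bool" where
  "closed_form f \<longleftrightarrow> (\<forall>i j. D_x i (f j) = D_x j (f i))"

text \<open>
  An operator $\sum_i a_i(t)\,\partial_t^i$ in $k(t)\langle\partial_t\rangle$ is represented by its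
  coefficient sequence, with the power of $\partial_t$ as the degree.  The commutative product of
  the polynomial type is not the composition of operators and is never used.
\<close>

type_synonym 'k diffop = "'k kt poly"

definition op_apply ::
  "'k::field_char_0 diffop \<Rightarrow> ('k, 'v::linorder) ratfun \<Rightarrow> ('k, 'v) ratfun" where
  "op_apply L f = (\<Sum>i\<le>degree L. of_kt (coeff L i) * (D_t ^^ i) f)"

definition certificate ::
  "('k::field_char_0, 'v::linorder) ratfun alg_closure \<Rightarrow> 'k diffop \<Rightarrow> ('k, 'v) one_form \<Rightarrow> bool"
  where
  "certificate g L f \<longleftrightarrow> (\<forall>i. to_ac (op_apply L (f i)) = ac_deriv (D_x i) g)"

definition telescoper ::
  "'k::field_char_0 diffop \<Rightarrow> ('k, 'v::linorder) one_form \<Rightarrow> bool" where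
  "telescoper L f \<longleftrightarrow> (\<exists>g. certificate g L f)"

definition minimal_telescoper ::
  "'k::field_char_0 diffop \<Rightarrow> ('k, 'v::linorder) one_form \<Rightarrow> bool" where
  "minimal_telescoper L f \<longleftrightarrow>
     L \<noteq> 0 \<and> telescoper L f \<and> (\<forall>L'. L' \<noteq> 0 \<and> telescoper L' f \<longrightarrow> degree L \<le> degree L')"


section \<open>Simple forms and Hermite reduction\<close>

text \<open>
  The last conjunct is what \<open>coprime a b\<close> unfolds to; the constant itself requires the class
  \<open>algebraic_semidom\<close>, of which the polynomial type is not an instance.
\<close>

definition lowest_terms ::
  "('k::field_char_0, 'v::linorder) ratfun \<Rightarrow> ('k, 'v) kt_mpoly \<Rightarrow> ('k, 'v) kt_mpoly \<Rightarrow> bool"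
  where
  "lowest_terms q a b \<longleftrightarrow>
     b \<noteq> 0 \<and> q = Fract a b \<and> (\<forall>c. c dvd a \<longrightarrow> c dvd b \<longrightarrow> c dvd 1)"

text \<open>Only meaningful for nonzero \<open>p\<close>.\<close>

definition deg_in :: "'v::linorder \<Rightarrow> ('k::field_char_0, 'v) kt_mpoly \<Rightarrow> nat" where
  "deg_in v p = Max ((\<lambda>e. Poly_Mapping.lookup e v) ` Poly_Mapping.keys p)"

text \<open>The disjunct \<open>a = 0\<close> implements $\deg(0) = -\infty$.\<close>

definition proper_in :: "'v::linorder \<Rightarrow> ('k::field_char_0, 'v) ratfun \<Rightarrow> bool" where
  "proper_in v q \<longleftrightarrow> (\<exists>a b. lowest_terms q a b \<and> (a = 0 \<or> deg_in v a < deg_in v b))"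

definition squarefree_denom :: "('k::field_char_0, 'v::linorder) ratfun \<Rightarrow> bool" where
  "squarefree_denom q \<longleftrightarrow> (\<exists>a b. lowest_terms q a b \<and> squarefree b)"

definition simple_form :: "('k::field_char_0, 'v::linorder) one_form \<Rightarrow> bool" where
  "simple_form h \<longleftrightarrow> closed_form h \<and> (\<forall>i. proper_in i (h i) \<and> squarefree_denom (h i))"

text \<open>
  The procedures used by the algorithm are arbitrary functions satisfying their specification;
  nothing is assumed about their values outside the specified inputs.
\<close>

definition hermite_one_form ::
  "(('k::field_char_0, 'v::linorder) one_form \<Rightarrow> ('k, 'v) ratfun \<times> ('k, 'v) one_form) \<Rightarrow> bool"
  where
  "hermite_one_form H \<longleftrightarrow>
     (\<forall>f. closed_form f \<longrightarrow>
        (case H f of (g, r) \<Rightarrow> simple_form r \<and> (\<forall>i. f i = D_x i g + r i)))"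


section \<open>The algorithm\<close>

text \<open>
  Linear relations are between the members of a list, not of a set: a repeated member makes the
  list dependent.
\<close>

definition lin_relation ::
  "(nat \<Rightarrow> 'k::field_char_0 kt) \<Rightarrow> ('k, 'v::linorder) one_form list \<Rightarrow> bool" where
  "lin_relation a R \<longleftrightarrow> (\<forall>i. (\<Sum>j<length R. of_kt (a j) * (R ! j) i) = 0)"

definition lin_indep :: "('k::field_char_0, 'v::linorder) one_form list \<Rightarrow> bool" where
  "lin_indep R \<longleftrightarrow> (\<forall>a. lin_relation a R \<longrightarrow> (\<forall>j<length R. a j = 0))"

definition relation_finder ::
  "(('k::field_char_0, 'v::linorder) one_form list \<Rightarrow> nat \<Rightarrow> 'k kt) \<Rightarrow> bool" where
  "relation_finder rel \<longleftrightarrow>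
     (\<forall>R. \<not> lin_indep R \<longrightarrow> lin_relation (rel R) R \<and> (\<exists>j<length R. rel R j \<noteq> 0))"

text \<open>
  The loop state is $(n, [g_0,\dots,g_n], [r_0,\dots,r_n])$; the result is \<open>None\<close> iff the loop
  does not terminate.
\<close>

definition ct_one_form ::
  "(('k::field_char_0, 'v::linorder) one_form \<Rightarrow> ('k, 'v) ratfun \<times> ('k, 'v) one_form) \<Rightarrow>
   (('k, 'v) one_form list \<Rightarrow> nat \<Rightarrow> 'k kt) \<Rightarrow>
   ('k, 'v) one_form \<Rightarrow> ('k diffop \<times> ('k, 'v) ratfun) option" where
  "ct_one_form H rel f =
     (let (g0, r0) = H f in
      case while_option
             (\<lambda>(n, G, R). lin_indep R)
             (\<lambda>(n, G, R).
                let n' = n + 1; (g, r) = H (\<lambda>i. D_t ((R ! (n' - 1)) i))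
                in (n', G @ [g], R @ [r]))
             (0, [g0], [r0])
      of None \<Rightarrow> None
       | Some (n, G, R) \<Rightarrow>
           let a = rel R in
           Some (\<Sum>i\<le>n. monom (a i) i,
                 \<Sum>i\<le>n. of_kt (a i) * (\<Sum>j\<le>i. (D_t ^^ (i - j)) (G ! j))))"


section \<open>The derivations are well-defined\<close>

lemma derivationD:
  assumes "derivation D"
  shows "D (x + y) = D x + D y" and "D (x * y) = D x * y + x * D y"
  using assms by (auto simp: derivation_def)

lemma derivation_0: "derivation D \<Longrightarrow> D 0 = 0"
  using derivationD(1)[of D 0 0] by simp

lemma derivation_1: "derivation D \<Longrightarrow> D 1 = 0"
  using derivationD(2)[of D 1 1] by simp

lemma fract_deriv_Fract:
  assumes d: "derivation d" and b: "b \<noteq> 0"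
  shows "fract_deriv d (Fract a b) = Fract (d a * b - a * d b) (b * b)"
proof -
  have eq: "Fract (d a * b - a * d b) (b * b) = Fract (d a' * b' - a' * d b') (b' * b')"
    if b': "b' \<noteq> 0" and q: "Fract a b = Fract a' b'" for a' b'
  proof -
    have h: "a * b' = a' * b" using q b b' by (simp add: eq_fract)
    have "d (a * b') = d (a' * b)" using h by simp
    hence h': "d a * b' + a * d b' = d a' * b + a' * d b"
      by (simp add: derivationD(2)[OF d])
    have "(d a * b - a * d b) * (b' * b') - (d a' * b' - a' * d b') * (b * b)
        = ((d a * b' + a * d b') - (d a' * b + a' * d b)) * (b * b')
          - (a * b' - a' * b) * (b * d b' + b' * d b)"
      by (simp add: algebra_simps)
    also have "\<dots> = 0" using h h' by simp
    finally show ?thesis using b b' by (simp add: eq_fract)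
  qed
  show ?thesis
    unfolding fract_deriv_def
    by (rule the_equality) (use eq b in blast)+
qed

lemma derivation_fract_deriv:
  assumes d: "derivation d"
  shows "derivation (fract_deriv d)"
  unfolding derivation_def
proof (intro conjI allI)
  fix x y :: "'a fract"
  obtain a b where x: "x = Fract a b" "b \<noteq> 0" by (cases x) auto
  obtain c e where y: "y = Fract c e" "e \<noteq> 0" by (cases y) auto
  show "fract_deriv d (x + y) = fract_deriv d x + fract_deriv d y"
    using x y by (simp add: fract_deriv_Fract[OF d] derivationD[OF d] eq_fract)
      (simp add: algebra_simps)
  show "fract_deriv d (x * y) = fract_deriv d x * y + x * fract_deriv d y"
    using x y by (simp add: fract_deriv_Fract[OF d] derivationD[OF d] eq_fract)
      (simp add: algebra_simps)
qed

lemma derivation_pderiv: "derivation (pderiv :: 'k::field_char_0 poly \<Rightarrow> _)"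
  by (simp add: derivation_def pderiv_add pderiv_mult algebra_simps)

lemma derivation_deriv_kt: "derivation (fract_deriv pderiv :: 'k::field_char_0 kt \<Rightarrow> _)"
  by (rule derivation_fract_deriv[OF derivation_pderiv])

lemma D_t_mpoly_lookup:
  "Poly_Mapping.lookup (D_t_mpoly p) e = fract_deriv pderiv (Poly_Mapping.lookup p e)"
  by (simp add: D_t_mpoly_def Poly_Mapping.map.rep_eq when_def derivation_0[OF derivation_deriv_kt])

lemma D_t_mpoly_add: "D_t_mpoly (p + q) = D_t_mpoly p + D_t_mpoly q"
  by (rule poly_mapping_eqI)
    (simp add: D_t_mpoly_lookup lookup_add derivationD[OF derivation_deriv_kt])

lemma D_t_mpoly_single:
  "D_t_mpoly (Poly_Mapping.single e c) = Poly_Mapping.single e (fract_deriv pderiv c)"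
  by (rule poly_mapping_eqI)
    (simp add: D_t_mpoly_lookup lookup_single when_def derivation_0[OF derivation_deriv_kt])

lemma D_x_mpoly_superset:
  assumes "finite A" "Poly_Mapping.keys p \<subseteq> A"
  shows "D_x_mpoly v p =
     (\<Sum>e\<in>A. Poly_Mapping.single (e - Poly_Mapping.single v 1)
          (of_nat (Poly_Mapping.lookup e v) * Poly_Mapping.lookup p e))"
  unfolding D_x_mpoly_def
  by (rule sum.mono_neutral_left) (use assms in \<open>auto simp: in_keys_iff\<close>)

lemma D_x_mpoly_add: "D_x_mpoly v (p + q) = D_x_mpoly v p + D_x_mpoly v q"
proof -
  let ?A = "Poly_Mapping.keys p \<union> Poly_Mapping.keys q"
  have "finite ?A" by simp
  moreover have "Poly_Mapping.keys (p + q) \<subseteq> ?A" by (rule Poly_Mapping.keys_add)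
  ultimately show ?thesis
    by (simp add: D_x_mpoly_superset[of ?A] lookup_add distrib_left single_add sum.distrib)
qed

lemma D_x_mpoly_single:
  "D_x_mpoly v (Poly_Mapping.single e c) =
     Poly_Mapping.single (e - Poly_Mapping.single v 1) (of_nat (Poly_Mapping.lookup e v) * c)"
  by (simp add: D_x_mpoly_superset[of "{e}"])

lemma poly_mapping_single_induct:
  fixes p :: "'b \<Rightarrow>\<^sub>0 'c::comm_monoid_add"
  assumes zero: "P 0" and step: "\<And>k v q. P q \<Longrightarrow> P (Poly_Mapping.single k v + q)"
  shows "P p"
proof (induction p rule: update_induct)
  case const
  show ?case by (rule zero)
next
  case (update g a b)
  have "Poly_Mapping.update a b g = Poly_Mapping.single a b + g"
    using update.hyps(1)
    by (intro poly_mapping_eqI)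
      (auto simp: lookup_update lookup_add lookup_single when_def in_keys_iff)
  then show ?case using step[OF update.IH] by simp
qed

lemma derivation_mpolyI:
  fixes D :: "('k::field_char_0, 'v::linorder) kt_mpoly \<Rightarrow> ('k, 'v) kt_mpoly"
  assumes add: "\<And>p q. D (p + q) = D p + D q"
    and mult: "\<And>e c e' c'. D (Poly_Mapping.single e c * Poly_Mapping.single e' c') =
      D (Poly_Mapping.single e c) * Poly_Mapping.single e' c' +
      Poly_Mapping.single e c * D (Poly_Mapping.single e' c')"
  shows "derivation D"
proof -
  have zero: "D 0 = 0" using add[of 0 0] by (metis add_cancel_right_right)
  have 1: "D (Poly_Mapping.single e c * q) =
      D (Poly_Mapping.single e c) * q + Poly_Mapping.single e c * D q" for e c q
    by (induction q rule: poly_mapping_single_induct)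
      (simp_all add: zero add mult distrib_left add_ac)
  have "D (p * q) = D p * q + p * D q" for p q
    by (induction p rule: poly_mapping_single_induct)
      (simp_all add: zero add 1 distrib_right add_ac)
  then show ?thesis by (simp add: derivation_def add)
qed

lemma derivation_D_t_mpoly: "derivation D_t_mpoly"
  by (rule derivation_mpolyI)
    (simp_all add: D_t_mpoly_add D_t_mpoly_single mult_single single_add
      derivationD[OF derivation_deriv_kt])

lemma derivation_D_x_mpoly: "derivation (D_x_mpoly v)"
proof (rule derivation_mpolyI)
  let ?s = "Poly_Mapping.single :: ('a \<Rightarrow>\<^sub>0 nat) \<Rightarrow> 'b kt \<Rightarrow> _" and ?l = "Poly_Mapping.lookup"
  let ?u = "Poly_Mapping.single v 1 :: 'a \<Rightarrow>\<^sub>0 nat"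
  fix e e' :: "'a \<Rightarrow>\<^sub>0 nat" and c c' :: "'b kt"
  have shift: "?s (a - ?u + b) (of_nat (?l a v) * x) = ?s (a + b - ?u) (of_nat (?l a v) * x)"
    for a b x
  proof (cases "?l a v = 0")
    case False
    then have "a - ?u + b = a + b - ?u"
      by (intro poly_mapping_eqI) (auto simp: lookup_add lookup_minus lookup_single when_def)
    then show ?thesis by simp
  qed simp
  show "D_x_mpoly v (?s e c * ?s e' c') =
      D_x_mpoly v (?s e c) * ?s e' c' + ?s e c * D_x_mpoly v (?s e' c')"
    using shift[of e e' "c * c'"] shift[of e' e "c * c'"]
    by (simp add: D_x_mpoly_single mult_single lookup_add algebra_simps flip: single_add)
qed (rule D_x_mpoly_add)

lemma derivation_D_t: "derivation D_t"
  unfolding D_t_def by (rule derivation_fract_deriv[OF derivation_D_t_mpoly])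

lemma derivation_D_x: "derivation (D_x v)"
  unfolding D_x_def by (rule derivation_fract_deriv[OF derivation_D_x_mpoly])

lemma D_t_Fract_1: "D_t (Fract p 1) = Fract (D_t_mpoly p) 1"
  by (simp add: D_t_def fract_deriv_Fract[OF derivation_D_t_mpoly]
      derivation_1[OF derivation_D_t_mpoly])

lemma D_x_Fract_1: "D_x v (Fract p 1) = Fract (D_x_mpoly v p) 1"
  by (simp add: D_x_def fract_deriv_Fract[OF derivation_D_x_mpoly]
      derivation_1[OF derivation_D_x_mpoly])

lemma D_t_of_kt: "D_t (of_kt c) = of_kt (fract_deriv pderiv c)"
  by (simp add: of_kt_def D_t_Fract_1 D_t_mpoly_single)

lemma D_x_of_kt: "D_x v (of_kt c) = 0"
  by (simp add: of_kt_def D_x_Fract_1 D_x_mpoly_single fract_collapse)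

definition x_var :: "'v::linorder \<Rightarrow> ('k::field_char_0, 'v) ratfun" where
  "x_var v = Fract (Poly_Mapping.single (Poly_Mapping.single v 1) 1) 1"

lemma D_t_x_var: "D_t (x_var v) = 0"
  by (simp add: x_var_def D_t_Fract_1 D_t_mpoly_single derivation_1[OF derivation_deriv_kt]
      fract_collapse)

lemma D_x_x_var: "D_x v (x_var w) = (if v = w then 1 else 0)"
  by (simp add: x_var_def D_x_Fract_1 D_x_mpoly_single lookup_single when_def fract_collapse)

end

theory Submission
  imports Defs
begin

text \<open>
  Write $K = k(t)$ and $F = K(x_1,\dots,x_m)$.  Modulo exact forms, $\partial_t^n \omega$ is
  represented by the $n$-th remainder $r_n$ of the algorithm.  The proof rests on a class of forms
  that contains all simple forms, is closed under $K$-linear combinations and meets the exact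
  forms only in $0$: the reduced forms \<open>reduced_form\<close>, whose coefficients $h_i$ are proper in
  $x_i$ and have at most simple poles along every prime of $K[x_1,\dots,x_m]$.

  Why a reduced form $dg$ with $g \in F$ vanishes (\<open>reduced_exact_zero\<close>): if $g$ had a pole along
  a prime $p$, then for some $i$ the prime $p$ does not divide $\partial_i p$, and $\partial_i g$ has
  a pole of order at least two (\<open>pole_of_derivative\<close>).  So $g$ is a polynomial, and so are its
  partial derivatives, which are proper in their own variable and hence $0$.  A certificate that is
  merely algebraic over $F$ may be replaced by one in $F$, namely a rational multiple of the
  subleading coefficient of its minimal polynomial (\<open>algebraic_primitive_descends\<close>).
  Therefore $\sum_i a_i \partial_t^i$ is a telescoper of $\omega$ if and only if
  $\sum_i a_i r_i = 0$, and the first linear relation among the remainders yields a telescoper of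
  minimal degree (\<open>telescoper_degree\<close>), with a certificate given by \<open>operator_reduction\<close>.

  Why such a relation exists (\<open>remainders_dependent\<close>): let $D$ be a common denominator of $r_0$.
  Neither $\partial_t$ nor the reduction creates poles along a prime that does not divide $D$
  (\<open>primitive_regular\<close>), so all $D r_n$ have polynomial coefficients.  Properness bounds the
  degree of the $i$-th coefficient of $r_n$ in $x_i$ only, but closedness carries the bound over to
  the other variables: if $h_i$ had positive degree in $x_j$, then $\partial_j h_i$ would not be
  proper in $x_j$, whereas $\partial_j h_i = \partial_i h_j$ is
  (\<open>degree_le_if_derivative_proper\<close>, \<open>reduced_form_bounded\<close>).  So all $r_n$ lie in a space of
  finite dimension over $K$.

  Two foundations are laid first.  A derivation of a field of characteristic zero extends to the
  algebraic closure (\<open>ac_deriv\<close>), so that certificates obey the expected rules.  And irreducible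
  polynomials in several variables are prime (\<open>irreducible_mpoly_prime\<close>), without which a
  squarefree denominator would say nothing about poles.
\<close>

section \<open>Derivations on the algebraic closure\<close>

instance fract :: ("{idom,ring_char_0}") field_char_0
proof
  show "inj (of_nat :: nat \<Rightarrow> 'a fract)"
    by (rule injI) (simp add: of_nat_fract eq_fract)
qed

lemma derivation_minus: "derivation D \<Longrightarrow> D (- x) = - D x"
  by (metis derivationD(1) derivation_0 add.right_inverse add_eq_0_iff)

lemma derivation_diff: "derivation D \<Longrightarrow> D (x - y) = D x - D y"
  by (metis derivationD(1) derivation_minus diff_conv_add_uminus)

lemma derivation_sum: "derivation D \<Longrightarrow> D (sum f A) = (\<Sum>x\<in>A. D (f x))"
  by (induction A rule: infinite_finite_induct) (auto simp: derivation_0 derivationD(1))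

lemma derivation_of_nat: "derivation D \<Longrightarrow> D (of_nat n) = 0"
  by (induction n) (auto simp: derivation_0 derivationD(1) derivation_1)

definition derivation_on :: "'b::comm_ring_1 set \<Rightarrow> ('b \<Rightarrow> 'b) \<Rightarrow> bool" where
  "derivation_on R d \<longleftrightarrow> (\<forall>x\<in>R. \<forall>y\<in>R. d (x + y) = d x + d y \<and> d (x * y) = d x * y + x * d y)"

text \<open>
  Between the base field and its algebraic closure every ring is a field
  (\<open>intermediate_ring_inverse\<close> below), so closure under division need not be required.
\<close>

definition intermediate_ring :: "'a::field alg_closure set \<Rightarrow> bool" where
  "intermediate_ring R \<longleftrightarrow>
     range to_ac \<subseteq> R \<and> (\<forall>x\<in>R. \<forall>y\<in>R. x + y \<in> R \<and> x * y \<in> R)"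

lemma intermediate_ringD:
  assumes "intermediate_ring R"
  shows "to_ac c \<in> R" "0 \<in> R" "1 \<in> R"
    and "x \<in> R \<Longrightarrow> y \<in> R \<Longrightarrow> x + y \<in> R" "x \<in> R \<Longrightarrow> y \<in> R \<Longrightarrow> x * y \<in> R"
    and "x \<in> R \<Longrightarrow> - x \<in> R" "x \<in> R \<Longrightarrow> y \<in> R \<Longrightarrow> x - y \<in> R" "x \<in> R \<Longrightarrow> x ^ n \<in> R"
proof -
  have c: "to_ac c \<in> R" for c using assms by (auto simp: intermediate_ring_def)
  show "to_ac c \<in> R" "0 \<in> R" "1 \<in> R" using c[of c] c[of 0] c[of 1] by simp_all
  have a: "x + y \<in> R" and m: "x * y \<in> R" if "x \<in> R" "y \<in> R" for x y
    using that assms by (auto simp: intermediate_ring_def)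
  have n: "- x \<in> R" if "x \<in> R" for x
    using m[OF c[of "-1"] that] by simp
  show "x \<in> R \<Longrightarrow> y \<in> R \<Longrightarrow> x + y \<in> R" "x \<in> R \<Longrightarrow> y \<in> R \<Longrightarrow> x * y \<in> R" by (rule a m; assumption)+
  show "x \<in> R \<Longrightarrow> - x \<in> R" by (rule n)
  show "x \<in> R \<Longrightarrow> y \<in> R \<Longrightarrow> x - y \<in> R" using a[of x "-y"] n[of y] by simp
  show "x \<in> R \<Longrightarrow> x ^ n \<in> R" by (induction n) (use c[of 1] m in auto)
qed

lemma intermediate_ring_sum:
  "intermediate_ring R \<Longrightarrow> (\<And>i. i \<in> A \<Longrightarrow> f i \<in> R) \<Longrightarrow> sum f A \<in> R"
  by (induction A rule: infinite_finite_induct) (auto intro: intermediate_ringD)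

lemma intermediate_ring_poly:
  assumes "intermediate_ring R" "\<And>i. coeff P i \<in> R" "x \<in> R"
  shows "poly P x \<in> R"
  unfolding poly_altdef by (intro intermediate_ring_sum intermediate_ringD assms)

text \<open>
  The inverse of a nonzero algebraic element is a polynomial in that element: solve
  $a + x\,q(x) = 0$ with $a \neq 0$ for $x^{-1}$.
\<close>

lemma intermediate_ring_inverse:
  assumes R: "intermediate_ring R" and x: "x \<in> R"
  shows "inverse x \<in> R"
proof (cases "x = 0")
  case False
  obtain p where p: "p \<noteq> 0" "poly (map_poly to_ac p) x = 0" by (rule alg_closure_algebraic)
  from p show ?thesis
  proof (induction p)
    case (pCons a p)
    let ?q = "poly (map_poly to_ac p) x"
    have eq: "to_ac a + x * ?q = 0" using pCons.prems by (simp add: map_poly_pCons)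
    show ?case
    proof (cases "a = 0")
      case True
      then show ?thesis using pCons eq False by auto
    next
      case a: False
      have "x * ?q = - to_ac a" using eq by (simp add: eq_neg_iff_add_eq_0 add.commute)
      then have "x * (- ?q * to_ac (inverse a)) = 1" using a by (simp flip: mult.assoc)
      then have "inverse x = - ?q * to_ac (inverse a)" by (rule inverse_unique)
      moreover have "?q \<in> R" by (rule intermediate_ring_poly[OF R _ x])
          (simp add: coeff_map_poly intermediate_ringD[OF R])
      ultimately show ?thesis using intermediate_ringD[OF R] by metis
    qed
  qed simp
qed (use intermediate_ringD[OF R] in simp)

lemma derivation_on_sum:
  assumes R: "intermediate_ring R" and d: "derivation_on R d" and f: "\<And>i. i \<in> A \<Longrightarrow> f i \<in> R"
  shows "d (sum f A) = (\<Sum>i\<in>A. d (f i))"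
proof -
  have 0: "d 0 = 0" using d intermediate_ringD(2)[OF R]
    by (metis (no_types, lifting) add_cancel_right_right derivation_on_def)
  show ?thesis using f
    by (induction A rule: infinite_finite_induct)
      (use 0 d in \<open>auto simp: derivation_on_def intermediate_ring_sum[OF R]\<close>)
qed

text \<open>
  The only candidate for the value at $P(b)$ of an extension of $d$ that sends $b$ to $c$.
\<close>

definition eval_deriv :: "('b::idom \<Rightarrow> 'b) \<Rightarrow> 'b \<Rightarrow> 'b \<Rightarrow> 'b poly \<Rightarrow> 'b" where
  "eval_deriv d b c P = poly (map_poly d P) b + poly (pderiv P) b * c"

lemma
  fixes R :: "'a::field alg_closure set"
  assumes R: "intermediate_ring R" and d: "derivation_on R d"
    and P: "\<And>i. coeff P i \<in> R" and Q: "\<And>i. coeff Q i \<in> R"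
  shows eval_deriv_add: "eval_deriv d b c (P + Q) = eval_deriv d b c P + eval_deriv d b c Q"
    and eval_deriv_mult:
      "eval_deriv d b c (P * Q) = eval_deriv d b c P * poly Q b + poly P b * eval_deriv d b c Q"
proof -
  have 0: "d 0 = 0" using derivation_on_sum[OF R d, of "{}"] by simp
  have "map_poly d (P + Q) = map_poly d P + map_poly d Q"
    using d P Q by (intro poly_eqI) (simp add: coeff_map_poly 0 derivation_on_def)
  then show "eval_deriv d b c (P + Q) = eval_deriv d b c P + eval_deriv d b c Q"
    by (simp add: eval_deriv_def pderiv_add algebra_simps)
  have "map_poly d (P * Q) = map_poly d P * Q + P * map_poly d Q"
  proof (intro poly_eqI)
    fix n
    have "d (coeff (P * Q) n) = (\<Sum>i\<le>n. d (coeff P i * coeff Q (n - i)))"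
      unfolding coeff_mult by (intro derivation_on_sum[OF R d] intermediate_ringD(5)[OF R] P Q)
    also have "\<dots> = (\<Sum>i\<le>n. d (coeff P i) * coeff Q (n - i) + coeff P i * d (coeff Q (n - i)))"
      using d P Q by (simp add: derivation_on_def)
    finally show "coeff (map_poly d (P * Q)) n = coeff (map_poly d P * Q + P * map_poly d Q) n"
      by (simp add: coeff_map_poly 0 coeff_mult sum.distrib)
  qed
  then show "eval_deriv d b c (P * Q) = eval_deriv d b c P * poly Q b + poly P b * eval_deriv d b c Q"
    by (simp add: eval_deriv_def pderiv_mult algebra_simps)
qed

lemma derivation_on_poly:
  fixes R :: "'a::field alg_closure set"
  assumes R: "intermediate_ring R" and d: "derivation_on R d"
    and P: "\<And>i. coeff P i \<in> R" and b: "b \<in> R"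
  shows "d (poly P b) = eval_deriv d b (d b) P"
  using P
proof (induction P)
  case 0
  show ?case using derivation_on_sum[OF R d, of "{}"] by (simp add: eval_deriv_def)
next
  case (pCons a P)
  have 0: "d 0 = 0" using derivation_on_sum[OF R d, of "{}"] by simp
  have a: "a \<in> R" using pCons.prems[of 0] by simp
  have P: "\<And>i. coeff P i \<in> R" using pCons.prems by (metis coeff_pCons_Suc)
  have "poly P b \<in> R" by (rule intermediate_ring_poly[OF R P b])
  then have "d (poly (pCons a P) b) = d a + (d b * poly P b + b * d (poly P b))"
    using d a b intermediate_ringD(5)[OF R b, of "poly P b"] by (simp add: derivation_on_def)
  then show ?case
    using pCons.IH[OF P] by (simp add: eval_deriv_def map_poly_pCons 0 pderiv_pCons algebra_simps)
qed

lemma exists_minimal_poly: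
  fixes R :: "'a::field alg_closure set"
  assumes R: "intermediate_ring R"
  obtains m where "m \<noteq> 0" "\<And>i. coeff m i \<in> R" "poly m b = 0"
    "\<And>P. P \<noteq> 0 \<Longrightarrow> (\<And>i. coeff P i \<in> R) \<Longrightarrow> poly P b = 0 \<Longrightarrow> degree m \<le> degree P"
proof -
  let ?S = "\<lambda>P. P \<noteq> 0 \<and> (\<forall>i. coeff P i \<in> R) \<and> poly P b = 0"
  obtain p where p: "p \<noteq> 0" "poly (map_poly to_ac p) b = 0" by (rule alg_closure_algebraic)
  have "?S (map_poly to_ac p)"
    using p intermediate_ringD(1)[OF R] by (auto simp: coeff_map_poly poly_eq_iff)
  then have "?S (arg_min degree ?S) \<and> (\<forall>P. ?S P \<longrightarrow> degree (arg_min degree ?S) \<le> degree P)"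
    by (rule arg_min_nat_lemma)
  then show ?thesis using that by blast
qed

text \<open>
  Extension to $R[b]$.  If $m$ is a polynomial of minimal degree over $R$ with root $b$, then the
  image $c$ of $b$ is forced by $m^d(b) + m'(b)\,c = 0$, where $m'(b) \neq 0$ in characteristic
  zero.  With this $c$ the expression \<open>eval_deriv\<close> vanishes at every polynomial over $R$ with root
  $b$, since such polynomials are multiples of $m$; so it defines a map on $R[b]$.
\<close>

lemma extend_derivation_simple:
  fixes R :: "'a::field_char_0 alg_closure set" and b :: "'a alg_closure"
  assumes R: "intermediate_ring R" and d: "derivation_on R d"
  obtains S e where "intermediate_ring S" "derivation_on S e" "R \<subseteq> S" "b \<in> S"
    "\<And>x. x \<in> R \<Longrightarrow> e x = d x"
proof -
  note rI = intermediate_ringD[OF R]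
  have 0: "d 0 = 0" using derivation_on_sum[OF R d, of "{}"] by simp
  obtain m where m: "m \<noteq> 0" "\<And>i. coeff m i \<in> R" "poly m b = 0"
    and min: "\<And>P. P \<noteq> 0 \<Longrightarrow> (\<And>i. coeff P i \<in> R) \<Longrightarrow> poly P b = 0 \<Longrightarrow> degree m \<le> degree P"
    by (rule exists_minimal_poly[OF R]) blast
  have dm: "degree m > 0"
  proof (rule ccontr)
    assume "\<not> degree m > 0"
    then obtain k where "m = [:k:]" by (auto elim: degree_eq_zeroE)
    then show False using m by simp
  qed
  have m': "poly (pderiv m) b \<noteq> 0"
  proof
    assume "poly (pderiv m) b = 0"
    moreover have "pderiv m \<noteq> 0" using dm by (simp add: pderiv_eq_0_iff)
    moreover have "coeff (pderiv m) i \<in> R" for i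
      using rI(5)[OF rI(1)[of "of_nat (Suc i)"] m(2)[of "Suc i"]]
      by (simp add: coeff_pderiv del: of_nat_Suc)
    ultimately show False using min[of "pderiv m"] dm by (simp add: degree_pderiv)
  qed
  define c where "c = - poly (map_poly d m) b / poly (pderiv m) b"
  define th where "th = eval_deriv d b c"
  have th_add: "th (P + Q) = th P + th Q"
    and th_mult: "th (P * Q) = th P * poly Q b + poly P b * th Q"
    if "\<And>i. coeff P i \<in> R" "\<And>i. coeff Q i \<in> R" for P Q
    unfolding th_def using that by (auto intro: eval_deriv_add[OF R d] eval_deriv_mult[OF R d])
  have th_m: "th m = 0" using m' by (simp add: th_def eval_deriv_def c_def)
  have vanish: "th P = 0" if "\<And>i. coeff P i \<in> R" "poly P b = 0" for P
    \<comment> \<open>Divide by $m$ one leading term at a time.\<close>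
    using that
  proof (induction "degree P" arbitrary: P rule: less_induct)
    case less
    show ?case
    proof (cases "P = 0")
      case True
      then show ?thesis by (simp add: th_def eval_deriv_def)
    next
      case False
      then have deg: "degree m \<le> degree P" using min less.prems by blast
      define A where "A = monom (lead_coeff P * inverse (lead_coeff m)) (degree P - degree m)"
      define Q where "Q = P - A * m"
      have A: "coeff A i \<in> R" for i
        using rI(5)[OF less.prems(1) intermediate_ring_inverse[OF R m(2)]] rI(2)
        by (simp add: A_def)
      have Am: "coeff (A * m) i \<in> R" for i
        unfolding coeff_mult by (intro intermediate_ring_sum[OF R] rI(5) A m)
      have Q: "coeff Q i \<in> R" for i
        unfolding Q_def coeff_diff by (intro rI(7) less.prems Am)
      have dA: "degree (A * m) = degree P" "lead_coeff (A * m) = lead_coeff P"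
      proof -
        have A0: "A \<noteq> 0" using False m(1) by (simp add: A_def)
        have "degree A = degree P - degree m"
          unfolding A_def using False m(1) by (intro degree_monom_eq) simp
        then show "degree (A * m) = degree P" using A0 m(1) deg by (simp add: degree_mult_eq)
        show "lead_coeff (A * m) = lead_coeff P"
          unfolding lead_coeff_mult using m(1) False by (simp add: A_def degree_monom_eq)
      qed
      have "degree Q < degree P"
      proof -
        have "degree P > 0" using deg dm by simp
        moreover have "degree Q \<le> degree P" using degree_diff_le[of P "degree P" "A * m"] dA by (simp add: Q_def)
        moreover have "coeff Q (degree P) = 0" using dA by (simp add: Q_def)
        ultimately show ?thesis
          by (metis coeff_0_degree_minus_1 diff_Suc_less le_neq_implies_less leading_coeff_0_iff degree_0)
      qed
      then have "th Q = 0" using less.hyps Q less.prems(2) m(3) by (simp add: Q_def)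
      moreover have "th (A * m) = 0" using th_mult[OF A m(2)] th_m m(3) by simp
      ultimately show ?thesis using th_add[OF Q Am] by (simp add: Q_def)
    qed
  qed
  have th_neg: "th (- P) = - th P" if "\<And>i. coeff P i \<in> R" for P
  proof -
    have "th P + th (- P) = th 0" using th_add[of P "-P"] that rI(6) by simp
    also have "th 0 = 0" by (simp add: th_def eval_deriv_def)
    finally show ?thesis by (simp add: eq_neg_iff_add_eq_0 add.commute)
  qed
  define e where "e = (\<lambda>x. th (SOME P. (\<forall>i. coeff P i \<in> R) \<and> poly P b = x))"
  have e_poly: "e (poly P b) = th P" if P: "\<And>i. coeff P i \<in> R" for P
  proof -
    let ?Q = "SOME Q. (\<forall>i. coeff Q i \<in> R) \<and> poly Q b = poly P b"
    have Q: "(\<forall>i. coeff ?Q i \<in> R) \<and> poly ?Q b = poly P b"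
      by (rule someI[of _ P]) (use P in simp)
    have mP: "coeff (- P) i \<in> R" for i using P rI(6) by simp
    have "th (?Q + - P) = 0" by (rule vanish) (use Q rI(4) mP in \<open>auto simp flip: diff_conv_add_uminus intro: rI(7) P\<close>)
    then show ?thesis using th_add[of ?Q "-P"] th_neg[OF P] Q mP by (simp add: e_def)
  qed
  define S where "S = {poly P b | P. \<forall>i. coeff P i \<in> R}"
  have inS: "poly P b \<in> S" if "\<And>i. coeff P i \<in> R" for P using that by (auto simp: S_def)
  have const: "coeff [:x:] i \<in> R" if "x \<in> R" for x i
    using that rI(2) by (simp add: coeff_pCons split: nat.split)
  have add: "coeff (P + Q) i \<in> R" and mult: "coeff (P * Q) i \<in> R"
    if "\<And>i. coeff P i \<in> R" "\<And>i. coeff Q i \<in> R" for P Q i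
    using that by (auto simp: coeff_mult intro!: rI(4) intermediate_ring_sum[OF R] rI(5))
  have RS: "R \<subseteq> S"
    using inS[OF const] by fastforce
  have S: "intermediate_ring S"
    unfolding intermediate_ring_def
  proof (intro conjI ballI)
    show "range to_ac \<subseteq> S" using RS rI(1) by blast
    fix x y assume "x \<in> S" "y \<in> S"
    then obtain P Q where PQ: "\<And>i. coeff P i \<in> R" "\<And>i. coeff Q i \<in> R" "x = poly P b" "y = poly Q b"
      by (auto simp: S_def)
    show "x + y \<in> S" using inS[OF add[OF PQ(1,2)]] PQ by simp
    show "x * y \<in> S" using inS[OF mult[OF PQ(1,2)]] PQ by simp
  qed
  have e: "derivation_on S e"
    unfolding derivation_on_def
  proof (intro ballI)
    fix x y assume "x \<in> S" "y \<in> S"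
    then obtain P Q where PQ: "\<And>i. coeff P i \<in> R" "\<And>i. coeff Q i \<in> R" "x = poly P b" "y = poly Q b"
      by (auto simp: S_def)
    show "e (x + y) = e x + e y \<and> e (x * y) = e x * y + x * e y"
      using e_poly[OF add[OF PQ(1,2)]] e_poly[OF mult[OF PQ(1,2)]] e_poly[OF PQ(1)] e_poly[OF PQ(2)]
        th_add[OF PQ(1,2)] th_mult[OF PQ(1,2)] PQ(3,4) by simp
  qed
  have "b \<in> S" using inS[of "[:0, 1:]"] rI(2,3) by (simp add: coeff_pCons split: nat.splits)
  moreover have "e x = d x" if "x \<in> R" for x
    using e_poly[OF const[OF that]] by (simp add: th_def eval_deriv_def map_poly_pCons 0)
  ultimately show ?thesis using that[OF S e RS] by blast
qed

lemma exists_minimal_poly_base: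
  fixes b :: "'a::field_char_0 alg_closure"
  obtains m :: "'a poly" where "lead_coeff m = 1" "poly (map_poly to_ac m) b = 0"
    "\<And>P. P \<noteq> 0 \<Longrightarrow> poly (map_poly to_ac P) b = 0 \<Longrightarrow> degree m \<le> degree P"
    "degree m > 0" "poly (map_poly to_ac (pderiv m)) b \<noteq> 0"
proof -
  let ?S = "\<lambda>P. P \<noteq> 0 \<and> poly (map_poly to_ac P) b = 0"
  obtain p where "?S p" using alg_closure_algebraic by blast
  then have "?S (arg_min degree ?S) \<and> (\<forall>P. ?S P \<longrightarrow> degree (arg_min degree ?S) \<le> degree P)"
    by (rule arg_min_nat_lemma)
  then obtain q where q: "?S q" and min: "\<And>P. ?S P \<Longrightarrow> degree q \<le> degree P" by blast
  define m where "m = smult (inverse (lead_coeff q)) q"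
  have lc: "lead_coeff m = 1" using q by (simp add: m_def)
  have ev: "poly (map_poly to_ac m) b = 0"
    using q by (simp add: m_def map_poly_smult)
  have dm: "degree m = degree q" using q by (simp add: m_def)
  have pos: "degree m > 0"
  proof (rule ccontr)
    assume "\<not> degree m > 0"
    then have "m = 1" using lc by (metis degree_eq_zeroE gr_zeroI lead_coeff_pCons(2) one_pCons)
    then show False using ev by simp
  qed
  have "poly (map_poly to_ac (pderiv m)) b \<noteq> 0"
    using min[of "pderiv m"] pos dm by (auto simp: pderiv_eq_0_iff degree_pderiv)
  then show ?thesis using that[of m] lc ev min dm pos by simp
qed

lemma derivation_on_algebraic:
  fixes R :: "'a::field_char_0 alg_closure set" and m :: "'a poly"
  assumes R: "intermediate_ring R" and d: "derivation_on R d"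
    and D: "derivation D" and ext: "\<And>x. d (to_ac x) = to_ac (D x)"
    and b: "b \<in> R" and m: "poly (map_poly to_ac m) b = 0"
  shows "poly (map_poly to_ac (map_poly D m)) b + poly (map_poly to_ac (pderiv m)) b * d b = 0"
proof -
  have "d (poly (map_poly to_ac m) b) = eval_deriv d b (d b) (map_poly to_ac m)"
    by (rule derivation_on_poly[OF R d _ b]) (simp add: coeff_map_poly intermediate_ringD[OF R])
  moreover have "d 0 = 0" using ext[of 0] by (simp add: derivation_0[OF D])
  moreover have "map_poly d (map_poly to_ac m) = map_poly to_ac (map_poly D m)"
    using ext by (intro poly_eqI) (simp add: coeff_map_poly derivation_0[OF D] \<open>d 0 = 0\<close>)
  moreover have "pderiv (map_poly to_ac m) = map_poly to_ac (pderiv m)"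
    by (intro poly_eqI) (simp add: coeff_map_poly coeff_pderiv)
  ultimately show ?thesis using m by (simp add: eval_deriv_def)
qed

text \<open>
  The minimal polynomial determines the value of an extension, so extensions to different
  intermediate rings agree wherever both are defined.
\<close>

lemma derivation_on_unique:
  fixes R :: "'a::field_char_0 alg_closure set"
  assumes "intermediate_ring R" "derivation_on R d" "\<And>x. d (to_ac x) = to_ac (D x)" "b \<in> R"
    and "intermediate_ring S" "derivation_on S e" "\<And>x. e (to_ac x) = to_ac (D x)" "b \<in> S"
    and D: "derivation D"
  shows "d b = e b"
proof -
  obtain m where m: "poly (map_poly to_ac m) b = 0" "poly (map_poly to_ac (pderiv m)) b \<noteq> 0"
    by (rule exists_minimal_poly_base)
  have "poly (map_poly to_ac (pderiv m)) b * d b = poly (map_poly to_ac (pderiv m)) b * e b"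
    using derivation_on_algebraic[OF assms(1,2) D assms(3,4) m(1)]
      derivation_on_algebraic[OF assms(5,6) D assms(7,8) m(1)]
    by (metis add_left_cancel)
  then show ?thesis using m(2) by simp
qed

text \<open>
  Glue all extensions to intermediate rings.  To verify the sum and product
  rules at $a$ and $b$ it suffices to have one extension that is defined at both, and two simple
  extensions provide it.
\<close>

lemma ac_deriv:
  fixes D :: "'a::field_char_0 \<Rightarrow> 'a"
  assumes D: "derivation D"
  shows "derivation (ac_deriv D)" and "ac_deriv D (to_ac x) = to_ac (D x)"
proof -
  let ?ok = "\<lambda>S e. intermediate_ring S \<and> derivation_on S e \<and> (\<forall>x. e (to_ac x) = to_ac (D x))"
  let ?F = "range (to_ac :: 'a \<Rightarrow> _)" and ?d = "\<lambda>x. to_ac (D (of_ac x))"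
  have F: "intermediate_ring ?F"
    by (auto simp: intermediate_ring_def simp flip: to_ac_add to_ac_mult)
  have d: "derivation_on ?F ?d"
    by (auto simp: derivation_on_def derivationD[OF D] simp flip: to_ac_add to_ac_mult)
  have ex: "\<exists>S e. ?ok S e \<and> a \<in> S \<and> b \<in> S" for a b
  proof -
    obtain S e where 1: "intermediate_ring S" "derivation_on S e" "?F \<subseteq> S" "a \<in> S"
      "\<And>x. x \<in> ?F \<Longrightarrow> e x = ?d x"
      by (rule extend_derivation_simple[OF F d, of a]) blast
    obtain T f where 2: "intermediate_ring T" "derivation_on T f" "S \<subseteq> T" "b \<in> T"
      "\<And>x. x \<in> S \<Longrightarrow> f x = e x"
      by (rule extend_derivation_simple[OF 1(1,2), of b]) blast
    have "f (to_ac x) = to_ac (D x)" for x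
      using 1(3) 1(5)[of "to_ac x"] 2(5)[of "to_ac x"] by auto
    then show ?thesis using 1 2 by blast
  qed
  define E where "E = (\<lambda>b. SOME y. \<exists>S e. ?ok S e \<and> b \<in> S \<and> e b = y)"
  have E: "E b = e b" if "?ok S e" "b \<in> S" for S e b
  proof -
    have "\<exists>S e. ?ok S e \<and> b \<in> S \<and> e b = E b"
      unfolding E_def by (rule someI_ex) (use that in blast)
    then obtain S' e' where *: "?ok S' e'" "b \<in> S'" "e' b = E b" by blast
    then have "e' b = e b" using that derivation_on_unique[of S' e' D b S e, OF _ _ _ _ _ _ _ _ D] by blast
    then show ?thesis using * by simp
  qed
  have dE: "derivation E"
    unfolding derivation_def
  proof (intro conjI allI)
    fix a b
    obtain S e where S: "?ok S e" "a \<in> S" "b \<in> S" using ex by blast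
    then have "a + b \<in> S" "a * b \<in> S" by (auto intro: intermediate_ringD)
    then show "E (a + b) = E a + E b" "E (a * b) = E a * b + a * E b"
      using S E[OF S(1)] by (auto simp: derivation_on_def)
  qed
  have extE: "E (to_ac x) = to_ac (D x)" for x
  proof -
    obtain S e where "?ok S e" "to_ac x \<in> S" using ex by blast
    then show ?thesis using E[of S e "to_ac x"] by simp
  qed
  have UN: "intermediate_ring (UNIV :: 'a alg_closure set)" by (simp add: intermediate_ring_def)
  have "ac_deriv D = E"
    unfolding ac_deriv_def
  proof (rule the_equality)
    show "derivation E \<and> (\<forall>x. E (to_ac x) = to_ac (D x))" using dE extE by blast
    fix G assume G: "derivation G \<and> (\<forall>x. G (to_ac x) = to_ac (D x))"
    then have "derivation_on UNIV G" by (simp add: derivation_on_def derivation_def)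
    then have "E b = G b" for b using E[of UNIV G b] G UN by blast
    then show "G = E" by auto
  qed
  then show "derivation (ac_deriv D)" "ac_deriv D (to_ac x) = to_ac (D x)"
    using dE extE by auto
qed

text \<open>
  Let $X^n + a X^{n-1} + \dots$ be the minimal polynomial of $g$.  Applying a derivation $D$ with
  $Dg = h$ to its value at $g$ gives a relation of degree less than $n$ for $g$, with
  $D a + n h$ as its coefficient of degree $n-1$.  By minimality that coefficient vanishes, so
  $-a/n$ is a primitive, the same one for all derivations at once.
\<close>

lemma algebraic_primitive_descends:
  fixes D :: "'i \<Rightarrow> 'a::field_char_0 \<Rightarrow> 'a"
  assumes D: "\<And>i. derivation (D i)" and g: "\<And>i. ac_deriv (D i) g = to_ac (h i)"
  shows "\<exists>g'. \<forall>i. h i = D i g'"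
proof -
  obtain m where m: "lead_coeff m = 1" "poly (map_poly to_ac m) g = 0"
    and min: "\<And>P. P \<noteq> 0 \<Longrightarrow> poly (map_poly to_ac P) g = 0 \<Longrightarrow> degree m \<le> degree P"
    and dm: "degree m > 0"
    by (rule exists_minimal_poly_base[of g]) blast
  define n where "n = degree m"
  have n0: "of_nat n \<noteq> (0::'a)" using dm by (simp add: n_def)
  have "h i = D i (- coeff m (n - 1) / of_nat n)" for i
  proof -
    note di = derivation_0[OF D] derivation_1[OF D]
    have UN: "intermediate_ring (UNIV :: 'a alg_closure set)" by (simp add: intermediate_ring_def)
    have "derivation_on UNIV (ac_deriv (D i))"
      using ac_deriv(1)[OF D] by (simp add: derivation_on_def derivation_def)
    then have *: "poly (map_poly to_ac (map_poly (D i) m)) g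
        + poly (map_poly to_ac (pderiv m)) g * to_ac (h i) = 0"
      using derivation_on_algebraic[OF UN _ D ac_deriv(2)[OF D] UNIV_I m(2)] g by metis
    define P where "P = map_poly (D i) m + smult (h i) (pderiv m)"
    have "map_poly to_ac P = map_poly to_ac (map_poly (D i) m) + smult (to_ac (h i)) (map_poly to_ac (pderiv m))"
      by (intro poly_eqI) (simp add: P_def coeff_map_poly)
    then have "poly (map_poly to_ac P) g = 0" using * by (simp add: mult.commute)
    moreover have "degree P < n"
    proof -
      have "coeff P j = 0" if "j \<ge> n" for j
      proof -
        have "coeff (map_poly (D i) m) j = 0"
          using that m(1) by (cases "j = n") (auto simp: coeff_map_poly di n_def coeff_eq_0)
        then show ?thesis using that by (simp add: P_def coeff_pderiv coeff_eq_0 n_def)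
      qed
      then show ?thesis using dm n_def by (metis degree_0 le_degree leading_coeff_0_iff linorder_not_less)
    qed
    ultimately have "P = 0" using min[of P] n_def by auto
    moreover have "coeff P (n - 1) = D i (coeff m (n - 1)) + h i * of_nat n"
      using dm m(1) by (simp add: P_def coeff_map_poly di coeff_pderiv n_def)
    ultimately have eq: "h i * of_nat n = - D i (coeff m (n - 1))"
      by (simp add: eq_neg_iff_add_eq_0 add.commute)
    let ?q = "- coeff m (n - 1) / of_nat n"
    have "D i (?q * of_nat n) = D i ?q * of_nat n"
      unfolding derivationD(2)[OF D] derivation_of_nat[OF D] by simp
    then have "D i ?q * of_nat n = h i * of_nat n"
      using n0 eq derivation_minus[OF D] by simp
    then show ?thesis using n0 by simp
  qed
  then show ?thesis by blast
qed

section \<open>Polynomials in several variables, expanded in one of them\<close>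

type_synonym ('a, 'v) mpoly = "('v \<Rightarrow>\<^sub>0 nat) \<Rightarrow>\<^sub>0 'a"

text \<open>
  Polynomials are finitely supported maps from exponent vectors to coefficients; \<open>lk\<close> reads off a
  coefficient of a polynomial or an entry of an exponent vector.
\<close>

abbreviation (input) lk :: "('b \<Rightarrow>\<^sub>0 'c::zero) \<Rightarrow> 'b \<Rightarrow> 'c" where "lk \<equiv> Poly_Mapping.lookup"
abbreviation (input) single :: "'b \<Rightarrow> 'c \<Rightarrow> 'b \<Rightarrow>\<^sub>0 'c::zero" where "single \<equiv> Poly_Mapping.single"

text \<open>
  A polynomial seen as a univariate polynomial in $x_v$ whose coefficients are polynomials free
  of $x_v$.  This injective ring homomorphism makes the theory of univariate polynomials over an
  integral domain available.
\<close>

definition expand :: "'v \<Rightarrow> ('a::field, 'v::linorder) mpoly \<Rightarrow> ('a, 'v) mpoly poly" where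
  "expand v p = (\<Sum>e\<in>Poly_Mapping.keys p.
     monom (single (Poly_Mapping.update v 0 e) (lk p e)) (lk e v))"

lemma expand_superset:
  assumes "finite A" "Poly_Mapping.keys p \<subseteq> A"
  shows "expand v p = (\<Sum>e\<in>A. monom (single (Poly_Mapping.update v 0 e) (lk p e)) (lk e v))"
  unfolding expand_def by (rule sum.mono_neutral_left) (use assms in \<open>auto simp: in_keys_iff\<close>)

lemma expand_add: "expand v (p + q) = expand v p + expand v q"
proof -
  let ?A = "Poly_Mapping.keys p \<union> Poly_Mapping.keys q"
  have "Poly_Mapping.keys (p + q) \<subseteq> ?A" by (rule Poly_Mapping.keys_add)
  then show ?thesis
    by (simp add: expand_superset[of ?A] lookup_add single_add sum.distrib flip: add_monom)
qed

lemma expand_single: "expand v (single e c) = monom (single (Poly_Mapping.update v 0 e) c) (lk e v)"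
  by (simp add: expand_superset[of "{e}"])

lemma update_0_add:
  "Poly_Mapping.update v 0 (e + e') = Poly_Mapping.update v 0 e + Poly_Mapping.update v (0::nat) e'"
  by (rule poly_mapping_eqI) (simp add: lookup_update lookup_add)

lemma expand_0 [simp]: "expand v 0 = 0"
  by (simp add: expand_def)

lemma expand_mult: "expand v (p * q) = expand v p * expand v q"
proof -
  have 1: "expand v (single e c * q) = expand v (single e c) * expand v q" for e c
    by (induction q rule: poly_mapping_single_induct)
      (simp_all add: expand_add distrib_left mult_single expand_single lookup_add mult_monom update_0_add)
  show ?thesis
    by (induction p rule: poly_mapping_single_induct)
      (simp_all add: 1 expand_add distrib_right)
qed

lemma expand_minus: "expand v (- p) = - expand v p"
  using expand_add[of v p "- p"] by (simp add: eq_neg_iff_add_eq_0 add.commute)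

lemma expand_diff: "expand v (p - q) = expand v p - expand v q"
  using expand_add[of v p "- q"] by (simp add: expand_minus)

lemma expand_sum: "expand v (sum f A) = (\<Sum>x\<in>A. expand v (f x))"
  by (induction A rule: infinite_finite_induct) (auto simp: expand_add)

text \<open>
  The exponents $k$ that contribute to the coefficient of $x_v^n$ are those of the form $e + n v$
  with $e$ free of $v$.
\<close>

lemma lookup_coeff_expand:
  fixes p :: "('a::field, 'v::linorder) mpoly"
  shows "lk (coeff (expand v p) n) e = (if lk e v = 0 then lk p (e + single v n) else 0)"
proof (induction p rule: poly_mapping_single_induct)
  case (2 k c q)
  have "(lk k v = n \<and> Poly_Mapping.update v 0 k = e) \<longleftrightarrow> (lk e v = 0 \<and> k = e + single v n)"
  proof
    assume *: "lk k v = n \<and> Poly_Mapping.update v 0 k = e"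
    then have "k = e + single v n"
      by (intro poly_mapping_eqI) (auto simp: lookup_add lookup_single lookup_update when_def)
    moreover have "lk e v = 0" using * by (auto simp: lookup_update)
    ultimately show "lk e v = 0 \<and> k = e + single v n" by blast
  next
    assume *: "lk e v = 0 \<and> k = e + single v n"
    then have "Poly_Mapping.update v 0 k = e"
      by (intro poly_mapping_eqI) (auto simp: lookup_add lookup_single lookup_update when_def)
    then show "lk k v = n \<and> Poly_Mapping.update v 0 k = e" using * by (simp add: lookup_add)
  qed
  then show ?case
    using 2 by (auto simp: expand_add expand_single lookup_add lookup_single when_def)
qed simp

lemma expand_eq_iff [simp]:
  fixes p q :: "('a::field, 'v::linorder) mpoly"
  shows "expand v p = expand v q \<longleftrightarrow> p = q"
proof
  assume *: "expand v p = expand v q"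
  show "p = q"
  proof (rule poly_mapping_eqI)
    fix e :: "'v \<Rightarrow>\<^sub>0 nat"
    let ?e = "Poly_Mapping.update v 0 e"
    have "lk r e = lk (coeff (expand v r) (lk e v)) ?e" for r :: "('a, 'v) mpoly"
    proof -
      have "?e + single v (lk e v) = e"
        by (rule poly_mapping_eqI) (auto simp: lookup_add lookup_single lookup_update when_def)
      then show ?thesis by (simp add: lookup_coeff_expand lookup_update)
    qed
    then show "lk p e = lk q e" using * by metis
  qed
qed simp

lemma expand_eq_0_iff [simp]: "expand v p = 0 \<longleftrightarrow> p = 0"
  using expand_eq_iff[of v p 0] by simp

definition deg :: "'v \<Rightarrow> ('a::field, 'v::linorder) mpoly \<Rightarrow> nat" where
  "deg v p = degree (expand v p)"

lemma deg_le_iff: "deg v p \<le> n \<longleftrightarrow> (\<forall>e. lk p e \<noteq> 0 \<longrightarrow> lk e v \<le> n)"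
proof
  assume *: "deg v p \<le> n"
  show "\<forall>e. lk p e \<noteq> 0 \<longrightarrow> lk e v \<le> n"
  proof (intro allI impI)
    fix e assume e: "lk p e \<noteq> 0"
    let ?e = "Poly_Mapping.update v 0 e"
    have "?e + single v (lk e v) = e"
      by (rule poly_mapping_eqI) (auto simp: lookup_add lookup_single lookup_update when_def)
    then have "lk (coeff (expand v p) (lk e v)) ?e \<noteq> 0"
      using e by (simp add: lookup_coeff_expand lookup_update)
    then have "coeff (expand v p) (lk e v) \<noteq> 0" by auto
    then show "lk e v \<le> n" using * le_degree deg_def by (metis order_trans)
  qed
next
  assume *: "\<forall>e. lk p e \<noteq> 0 \<longrightarrow> lk e v \<le> n"
  show "deg v p \<le> n"
    unfolding deg_def
  proof (rule degree_le, intro allI impI poly_mapping_eqI)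
    fix i e assume "n < i"
    then show "lk (coeff (expand v p) i) e = lk 0 e"
      using * by (auto simp: lookup_coeff_expand lookup_add)
  qed
qed

lemma deg_in_eq: "p \<noteq> 0 \<Longrightarrow> deg_in v p = deg v p"
proof (rule order.antisym)
  assume p: "p \<noteq> 0"
  have "\<forall>e. lk p e \<noteq> 0 \<longrightarrow> lk e v \<le> deg v p"
    using deg_le_iff[of v p "deg v p"] by simp
  then show "deg_in v p \<le> deg v p"
    unfolding deg_in_def using p by (subst Max_le_iff) (auto simp: in_keys_iff)
  show "deg v p \<le> deg_in v p"
    unfolding deg_le_iff deg_in_def by (auto intro!: Max_ge simp: in_keys_iff)
qed

lemma deg_0 [simp]: "deg v 0 = 0"
  by (simp add: deg_def)

lemma deg_mult: "p \<noteq> 0 \<Longrightarrow> q \<noteq> 0 \<Longrightarrow> deg v (p * q) = deg v p + deg v q"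
  by (simp add: deg_def expand_mult degree_mult_eq)

lemma deg_mult_le: "deg v (p * q) \<le> deg v p + deg v q"
  by (simp add: deg_def expand_mult degree_mult_le)

lemma deg_add_le: "deg v p \<le> n \<Longrightarrow> deg v q \<le> n \<Longrightarrow> deg v (p + q) \<le> n"
  by (simp add: deg_def expand_add degree_add_le)

lemma deg_diff_le: "deg v p \<le> n \<Longrightarrow> deg v q \<le> n \<Longrightarrow> deg v (p - q) \<le> n"
  by (simp add: deg_def expand_diff degree_diff_le)

lemma deg_dvd: "p dvd q \<Longrightarrow> q \<noteq> 0 \<Longrightarrow> deg v p \<le> deg v q"
  by (auto simp: dvd_def deg_mult)

lemma deg_coeff_expand: "deg w (coeff (expand v p) n) \<le> (if w = v then 0 else deg w p)"
proof -
  have "\<forall>e. lk p e \<noteq> 0 \<longrightarrow> lk e w \<le> deg w p"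
    using deg_le_iff[of w p "deg w p"] by simp
  then show ?thesis
    unfolding deg_le_iff lookup_coeff_expand
    by (auto simp: lookup_add split: if_splits)
qed

lemma expand_const:
  fixes p :: "('a::field, 'v::linorder) mpoly"
  assumes "deg v p = 0"
  shows "expand v p = [:p:]"
proof (rule poly_eqI, rule poly_mapping_eqI)
  have *: "lk p e = 0" if "lk e v \<noteq> 0" for e
    using deg_le_iff[of v p 0] assms that by auto
  fix n e
  show "lk (coeff (expand v p) n) e = lk (coeff [:p:] n) e"
  proof (cases n)
    case 0
    then show ?thesis using *[of e] by (simp add: lookup_coeff_expand)
  next
    case (Suc m)
    have "lk p (e + single v n) = 0" by (rule *) (simp add: lookup_add Suc)
    then show ?thesis by (simp add: lookup_coeff_expand Suc)
  qed
qed

lemma expand_mult_power: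
  fixes c :: "('a::field, 'v::linorder) mpoly"
  assumes "deg v c = 0"
  shows "expand v (c * single (single v n) 1) = monom c n"
proof -
  have "Poly_Mapping.update v 0 (single v n) = 0"
    by (rule poly_mapping_eqI) (auto simp: lookup_update lookup_single when_def)
  then have "expand v (single (single v n) (1::'a)) = monom 1 n"
    by (simp add: expand_single)
  then show ?thesis using assms by (simp add: expand_mult expand_const smult_monom)
qed

lemma expand_expansion:
  "p = (\<Sum>n\<le>deg v p. coeff (expand v p) n * single (single v n) 1)"
proof -
  have "expand v (\<Sum>n\<le>deg v p. coeff (expand v p) n * single (single v n) 1)
      = (\<Sum>n\<le>deg v p. monom (coeff (expand v p) n) n)"
    unfolding expand_sum
    using deg_coeff_expand[of v v p] by (intro sum.cong refl expand_mult_power) simp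
  also have "\<dots> = expand v p" by (simp add: deg_def poly_as_sum_of_monoms)
  finally show ?thesis unfolding expand_eq_iff by (rule sym)
qed

lemma deg_single_0 [simp]: "deg v (single 0 c) = 0"
  using deg_le_iff[of v "single 0 c" 0] by (simp add: lookup_single when_def)

lemma deg_1 [simp]: "deg v 1 = 0"
  using deg_single_0[of v 1] by simp

lemma deg_all_0: "(\<And>v. deg v p = 0) \<Longrightarrow> p = single 0 (lk p 0)"
proof (rule poly_mapping_eqI)
  fix e assume "\<And>v. deg v p = 0"
  then have *: "lk p e \<noteq> 0 \<Longrightarrow> lk e v = 0" for v
    using deg_le_iff[of v p 0] by simp
  have "e = 0" if "lk p e \<noteq> 0"
    by (rule poly_mapping_eqI) (use *[OF that] in simp)
  then show "lk p e = lk (single 0 (lk p 0)) e" by (auto simp: lookup_single when_def)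
qed

text \<open>
  The sum of the partial degrees is additive on products and vanishes, among nonzero polynomials,
  exactly at the units.  It therefore serves as a measure for descending along proper divisors.
\<close>

definition degree_sum :: "('a::field, 'v::{finite,linorder}) mpoly \<Rightarrow> nat" where
  "degree_sum p = (\<Sum>v\<in>UNIV. deg v p)"

lemma degree_sum_mult: "p \<noteq> 0 \<Longrightarrow> q \<noteq> 0 \<Longrightarrow> degree_sum (p * q) = degree_sum p + degree_sum q"
  by (simp add: degree_sum_def deg_mult sum.distrib)

lemma dvd_1_iff_deg:
  fixes p :: "('a::field, 'v::linorder) mpoly"
  assumes "p \<noteq> 0"
  shows "p dvd 1 \<longleftrightarrow> (\<forall>v. deg v p = 0)"
proof
  assume "p dvd 1"
  then show "\<forall>v. deg v p = 0" using deg_dvd[of p 1] by simp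
next
  assume *: "\<forall>v. deg v p = 0"
  define c where "c = lk p 0"
  have p: "p = single 0 c" unfolding c_def using * by (intro deg_all_0) simp
  then have "c \<noteq> 0" using assms by auto
  then have "1 = p * single 0 (inverse c)" unfolding p by (simp add: mult_single)
  then show "p dvd 1" by (rule dvdI)
qed

lemma degree_sum_pos:
  fixes p :: "('a::field, 'v::{finite,linorder}) mpoly"
  assumes "p \<noteq> 0" "\<not> p dvd 1" shows "degree_sum p > 0"
proof -
  obtain v where "deg v p > 0" using assms by (auto simp: dvd_1_iff_deg)
  then show ?thesis unfolding degree_sum_def by (intro sum_pos2[of _ v]) auto
qed

lemma exists_irreducible_factor:
  fixes b :: "('a::field, 'v::{finite,linorder}) mpoly"
  assumes "b \<noteq> 0" "\<not> b dvd 1"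
  obtains p where "irreducible p" "p dvd b"
proof -
  have "\<exists>p. irreducible p \<and> p dvd b" using assms
  proof (induction "degree_sum b" arbitrary: b rule: less_induct)
    case less
    show ?case
    proof (cases "irreducible b")
      case False
      then obtain x y where xy: "b = x * y" "\<not> x dvd 1" "\<not> y dvd 1"
        using less.prems by (auto simp: irreducible_def)
      then have "x \<noteq> 0" "y \<noteq> 0" using less.prems by auto
      then have "degree_sum x < degree_sum b" using degree_sum_pos[of y] xy by (simp add: degree_sum_mult)
      then show ?thesis using less.hyps[of x] xy \<open>x \<noteq> 0\<close> by (meson dvd_mult2)
    qed auto
  qed
  then show ?thesis using that by blast
qed

section \<open>Unique factorization in several variables\<close>

text \<open>
  The rings $K[x_v : v \in A]$ for varying sets $A$ of variables, realized as subsets of one type so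
  that induction on $A$ is possible.
\<close>

definition only_vars :: "'v set \<Rightarrow> ('a::field, 'v::linorder) mpoly set" where
  "only_vars A = {p. \<forall>v. v \<notin> A \<longrightarrow> deg v p = 0}"

lemma only_vars_arith:
  assumes "p \<in> only_vars A" "q \<in> only_vars A"
  shows "p + q \<in> only_vars A" "p - q \<in> only_vars A" "p * q \<in> only_vars A"
proof -
  have *: "deg v p = 0" "deg v q = 0" "deg v (p * q) = 0" if "v \<notin> A" for v
    using assms that deg_mult_le[of v p q] by (auto simp: only_vars_def)
  show "p + q \<in> only_vars A" "p - q \<in> only_vars A" "p * q \<in> only_vars A"
    unfolding only_vars_def using deg_add_le[of _ p 0 q] deg_diff_le[of _ p 0 q] *
    by simp_all
qed

lemma only_vars_factor: "p * q \<in> only_vars A \<Longrightarrow> p * q \<noteq> 0 \<Longrightarrow> q \<in> only_vars A"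
  by (auto simp: only_vars_def deg_mult)

lemma only_vars_coeff:
  assumes "p \<in> only_vars (insert v A)"
  shows "coeff (expand v p) n \<in> only_vars A"
proof -
  have "deg w (coeff (expand v p) n) = 0" if "w \<notin> A" for w
    using deg_coeff_expand[of w v p n] assms that by (cases "w = v") (simp_all add: only_vars_def)
  then show ?thesis by (simp add: only_vars_def)
qed

lemma only_vars_mono: "A \<subseteq> B \<Longrightarrow> only_vars A \<subseteq> only_vars B"
  by (auto simp: only_vars_def)

lemma only_vars_insertD:
  assumes p: "p \<in> only_vars (insert v A)" and "deg v p = 0"
  shows "p \<in> only_vars A"
proof -
  have "deg w p = 0" if "w \<notin> A" for w
    using assms that by (cases "w = v") (simp_all add: only_vars_def)
  then show ?thesis by (simp add: only_vars_def)
qed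

text \<open>
  Divisibility is meant in the full polynomial ring.  By additivity of degrees it agrees with
  divisibility among the polynomials in the variables \<open>A\<close>; only the factors tested are restricted.
\<close>

definition prime_within :: "'v set \<Rightarrow> ('a::field, 'v::linorder) mpoly \<Rightarrow> bool" where
  "prime_within A p \<longleftrightarrow>
     (\<forall>f\<in>only_vars A. \<forall>g\<in>only_vars A. p dvd f * g \<longrightarrow> p dvd f \<or> p dvd g)"

lemma dvd_iff_dvd_coeffs:
  assumes "deg v p = 0"
  shows "p dvd f \<longleftrightarrow> (\<forall>n. p dvd coeff (expand v f) n)"
proof
  assume "p dvd f"
  then show "\<forall>n. p dvd coeff (expand v f) n" by (auto simp: dvd_def expand_mult expand_const[OF assms])
next
  assume "\<forall>n. p dvd coeff (expand v f) n"
  then have "p dvd (\<Sum>n\<le>deg v f. coeff (expand v f) n * single (single v n) 1)"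
    by (intro dvd_sum) simp
  then show "p dvd f" by (simp flip: expand_expansion)
qed

text \<open>
  A prime of a ring stays prime in polynomials over that ring: if $p$ divides neither $f$ nor $g$,
  take the first coefficients $f_n$ and $g_m$ not divisible by $p$ and look at the coefficient
  $n+m$ of $f g$.
\<close>

lemma prime_within_insert:
  fixes p :: "('a::field, 'v::linorder) mpoly"
  assumes p: "p \<in> only_vars A" and prime: "prime_within A p" and v: "v \<notin> A"
  shows "prime_within (insert v A) p"
  unfolding prime_within_def
proof (intro ballI impI, rule ccontr)
  have dp: "deg v p = 0" using p v by (simp add: only_vars_def)
  fix f g :: "('a, 'v) mpoly"
  assume f: "f \<in> only_vars (insert v A)" and g: "g \<in> only_vars (insert v A)"
    and fg: "p dvd f * g" and neg: "\<not> (p dvd f \<or> p dvd g)"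
  let ?f = "coeff (expand v f)" and ?g = "coeff (expand v g)"
  define n where "n = (LEAST n. \<not> p dvd ?f n)"
  define m where "m = (LEAST n. \<not> p dvd ?g n)"
  have n: "\<not> p dvd ?f n" "\<And>i. i < n \<Longrightarrow> p dvd ?f i"
    unfolding n_def using neg dvd_iff_dvd_coeffs[OF dp] by (metis LeastI, metis not_less_Least)
  have m: "\<not> p dvd ?g m" "\<And>i. i < m \<Longrightarrow> p dvd ?g i"
    unfolding m_def using neg dvd_iff_dvd_coeffs[OF dp] by (metis LeastI, metis not_less_Least)
  have "p dvd coeff (expand v (f * g)) (n + m)" using fg dvd_iff_dvd_coeffs[OF dp] by blast
  also have "coeff (expand v (f * g)) (n + m) = (\<Sum>i\<le>n + m. ?f i * ?g (n + m - i))"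
    by (simp add: expand_mult coeff_mult)
  also have "\<dots> = ?f n * ?g m + (\<Sum>i\<in>{..n + m} - {n}. ?f i * ?g (n + m - i))"
    by (subst sum.remove[of _ n]) auto
  finally have *: "p dvd ?f n * ?g m + (\<Sum>i\<in>{..n + m} - {n}. ?f i * ?g (n + m - i))" .
  have "p dvd (\<Sum>i\<in>{..n + m} - {n}. ?f i * ?g (n + m - i))"
  proof (rule dvd_sum)
    fix i assume "i \<in> {..n + m} - {n}"
    then have "i < n \<or> n + m - i < m" by auto
    then show "p dvd ?f i * ?g (n + m - i)" using n(2) m(2) by auto
  qed
  then have "p dvd ?f n * ?g m" using * by (simp add: dvd_add_left_iff)
  then show False
    using prime only_vars_coeff[OF f] only_vars_coeff[OF g] n(1) m(1)
    unfolding prime_within_def by blast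
qed

text \<open>
  Division with remainder in one variable, after multiplication by a power of the leading
  coefficient of the divisor.
\<close>

lemma pseudo_division:
  fixes c f :: "('a::field, 'v::linorder) mpoly"
  assumes c: "c \<in> only_vars (insert v A)" "c \<noteq> 0" and f: "f \<in> only_vars (insert v A)" and v: "v \<notin> A"
  obtains s q r where "s \<in> only_vars A" "s \<noteq> 0" "q \<in> only_vars (insert v A)"
    "s * f = c * q + r" "r = 0 \<or> deg v r < deg v c"
proof -
  let ?B = "only_vars (insert v A)"
  have AB: "only_vars A \<subseteq> ?B" by (rule only_vars_mono) auto
  have zero: "0 \<in> ?B" "1 \<in> only_vars A" by (auto simp: only_vars_def)
  have X: "single (single v n) (1::'a) \<in> ?B" for n
    using deg_le_iff[of _ "single (single v n) (1::'a)" 0] by (auto simp: only_vars_def lookup_single when_def split: if_splits)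
  have "\<exists>s q r. s \<in> only_vars A \<and> s \<noteq> 0 \<and> q \<in> ?B \<and> s * f = c * q + r \<and> (r = 0 \<or> deg v r < deg v c)"
    using f
  proof (induction "deg v f" arbitrary: f rule: less_induct)
    case less
    show ?case
    proof (cases "f = 0 \<or> deg v f < deg v c")
      case True
      then show ?thesis using zero by (intro exI[of _ 1] exI[of _ 0] exI[of _ f]) auto
    next
      case False
      define lf lc where "lf = lead_coeff (expand v f)" and "lc = lead_coeff (expand v c)"
      have lfA: "lf \<in> only_vars A" and lcA: "lc \<in> only_vars A"
        unfolding lf_def lc_def by (rule only_vars_coeff less.prems c)+
      have l0: "lf \<noteq> 0" "lc \<noteq> 0" using False c by (auto simp: lf_def lc_def)
      define M where "M = lf * single (single v (deg v f - deg v c)) 1"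
      have MB: "M \<in> ?B" unfolding M_def using lfA AB X by (blast intro: only_vars_arith)
      have dl: "deg v lf = 0" "deg v lc = 0" using lfA lcA v by (auto simp: only_vars_def)
      define h where "h = lc * f - M * c"
      have uh: "expand v h = smult lc (expand v f) - monom lf (deg v f - deg v c) * expand v c"
        unfolding h_def expand_diff expand_mult[of v lc] expand_mult[of v M] expand_const[OF dl(2)]
        by (simp add: M_def expand_mult_power[OF dl(1)])
      have hB: "h \<in> ?B" unfolding h_def using lcA AB MB c less.prems by (blast intro: only_vars_arith)
      have "h = 0 \<or> deg v h < deg v f"
      proof -
        have "degree (monom lf (deg v f - deg v c) * expand v c) = degree (expand v f)"
          using l0 c False by (simp add: degree_mult_eq degree_monom_eq deg_def)
        moreover have "coeff (monom lf (deg v f - deg v c) * expand v c) (degree (expand v f)) = lf * lc"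
          using False by (simp add: coeff_monom_mult deg_def lc_def)
        ultimately have "degree (expand v h) \<le> degree (expand v f)" "coeff (expand v h) (degree (expand v f)) = 0"
          unfolding uh using degree_smult_le[of lc "expand v f"]
          by (auto intro!: degree_diff_le simp: lf_def mult.commute)
        then show ?thesis
          by (metis deg_def le_neq_implies_less leading_coeff_0_iff expand_eq_0_iff)
      qed
      then have "\<exists>s q r. s \<in> only_vars A \<and> s \<noteq> 0 \<and> q \<in> ?B \<and> s * h = c * q + r \<and> (r = 0 \<or> deg v r < deg v c)"
      proof
        assume "h = 0"
        then show ?thesis using zero by (intro exI[of _ 1] exI[of _ 0] exI[of _ 0]) auto
      qed (use less.hyps hB in blast)
      then obtain s q r where s: "s \<in> only_vars A" "s \<noteq> 0" "q \<in> ?B" "s * h = c * q + r"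
        "r = 0 \<or> deg v r < deg v c" by blast
      have "s * lc * f = c * (q + s * M) + r"
        using s(4) by (simp add: h_def algebra_simps)
      moreover have "s * lc \<in> only_vars A" "q + s * M \<in> ?B"
        using s lcA MB AB by (auto intro!: only_vars_arith)
      ultimately show ?thesis using s l0 by (metis mult_eq_0_iff)
    qed
  qed
  then show ?thesis using that by blast
qed

text \<open>
  The inductive step is Gauss's argument for an irreducible $p$ that involves the new variable $v$.
  By the induction hypothesis nonzero polynomials in the variables \<open>A\<close> are, up to a unit,
  products of primes that do not divide $p$, so they can be cancelled from divisibility statements about $p$.
\<close>

context
  fixes A :: "'v::{finite,linorder} set" and v :: 'v and p :: "('a::field, 'v) mpoly"
  assumes v: "v \<notin> A"
    and IH: "\<And>q :: ('a, 'v) mpoly. q \<in> only_vars A \<Longrightarrow> irreducible q \<Longrightarrow> prime_within A q"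
    and p: "p \<in> only_vars (insert v A)" and irr: "irreducible p" and dp: "deg v p > 0"
begin

text \<open>
  A prime factor of $s$, free of $v$, cannot divide $p$: the irreducible $p$ would be associated to
  it and hence also free of $v$.
\<close>

lemma coefficient_factor:
  assumes "s \<in> only_vars A" "s \<noteq> 0" "\<not> s dvd 1"
  obtains q s' where "s = q * s'" "q \<in> only_vars A" "s' \<in> only_vars A" "s' \<noteq> 0" "\<not> q dvd 1" "q \<noteq> 0"
    "prime_within (insert v A) q" "degree_sum s' < degree_sum s" "\<not> q dvd p"
proof -
  obtain q where q: "irreducible q" "q dvd s" using exists_irreducible_factor assms by blast
  then obtain s' where s': "s = q * s'" by blast
  have nz: "q \<noteq> 0" "s' \<noteq> 0" using s' assms by auto
  have nu: "\<not> q dvd 1" using q by (simp add: irreducible_def)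
  have qA: "q \<in> only_vars A" using only_vars_factor[of s' q A] s' assms by (simp add: mult.commute)
  have s'A: "s' \<in> only_vars A" using only_vars_factor[of q s' A] s' assms by simp
  have "\<not> q dvd p"
  proof
    assume "q dvd p"
    then obtain u where u: "p = q * u" by blast
    then have "u dvd 1" using irr nu by (auto simp: irreducible_def)
    moreover have "u \<noteq> 0" using u dp by auto
    ultimately have "deg v u = 0" by (simp add: dvd_1_iff_deg)
    then have "deg v p = 0" using u nz \<open>u \<noteq> 0\<close> qA v by (simp add: deg_mult only_vars_def)
    then show False using dp by simp
  qed
  moreover have "degree_sum s' < degree_sum s" using degree_sum_pos[OF nz(1) nu] s' nz by (simp add: degree_sum_mult)
  ultimately show ?thesis
    using that s' qA s'A nz nu prime_within_insert[OF qA IH[OF qA q(1)] v] by blast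
qed

lemma cancel_coefficient:
  assumes "s \<in> only_vars A" "s \<noteq> 0" "f \<in> only_vars (insert v A)" "p dvd s * f"
  shows "p dvd f"
  using assms
proof (induction "degree_sum s" arbitrary: s rule: less_induct)
  case less
  show ?case
  proof (cases "s dvd 1 \<or> f = 0")
    case True
    then show ?thesis
    proof
      assume "s dvd 1"
      then obtain u where u: "1 = s * u" by (rule dvdE)
      have "u * (s * f) = (s * u) * f" by (simp only: mult_ac)
      then have "u * (s * f) = f" unfolding u[symmetric] by simp
      then show ?thesis using dvd_mult[OF less.prems(4), of u] by metis
    qed simp
  next
    case False
    then obtain q s' where q: "s = q * s'" "q \<in> only_vars A" "s' \<in> only_vars A" "s' \<noteq> 0" "q \<noteq> 0"
      "prime_within (insert v A) q" "degree_sum s' < degree_sum s" "\<not> q dvd p"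
      using coefficient_factor less.prems by metis
    obtain h where h: "s * f = p * h" using less.prems by blast
    have "s * f \<in> only_vars (insert v A)"
      using less.prems only_vars_mono[of A "insert v A"] by (blast intro: only_vars_arith)
    moreover have "p * h \<noteq> 0" using h False less.prems by (metis mult_eq_0_iff)
    ultimately have "h \<in> only_vars (insert v A)" using h only_vars_factor[of p h] by simp
    moreover have "q dvd p * h" using h q by (metis dvd_triv_left mult.assoc)
    ultimately have "q dvd h" using q p unfolding prime_within_def by blast
    then obtain h' where "h = q * h'" by blast
    then have "s' * f = p * h'" using h q by (simp add: mult.left_commute mult.assoc)
    then show ?thesis using less.hyps[OF q(7,3,4) less.prems(3)] by simp
  qed
qed

text \<open>
  Distribute the prime factors of $s$ over $c$ and $d$.  What remains is a factorization of $p$, in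
  which the factor coming from $c$ still involves $v$, so it is associated to $p$.
\<close>

lemma dvd_of_coefficient_multiple:
  assumes "s \<in> only_vars A" "s \<noteq> 0" "c \<in> only_vars (insert v A)" "deg v c > 0" "s * p = c * d"
  shows "p dvd c"
  using assms
proof (induction "degree_sum s" arbitrary: s c d rule: less_induct)
  case less
  have p0: "p \<noteq> 0" using dp by auto
  show ?case
  proof (cases "s dvd 1")
    case True
    then obtain u where u: "1 = s * u" by (rule dvdE)
    have "c * (d * u) = (s * p) * u" unfolding less.prems(5) by (rule mult.assoc[symmetric])
    also have "\<dots> = (s * u) * p" by (simp only: mult_ac)
    finally have *: "p = c * (d * u)" unfolding u[symmetric] by simp
    have c0: "c \<noteq> 0" using * p0 by (metis mult_zero_left)
    have "\<not> c dvd 1" unfolding dvd_1_iff_deg[OF c0] using less.prems(4) by (metis less_irrefl)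
    then have "d * u dvd 1" using irreducibleD[OF irr *] by blast
    then obtain w where w: "1 = d * u * w" by (rule dvdE)
    have "c * (d * u) * w = c * (d * u * w)" by (rule mult.assoc)
    then have "c = p * w" unfolding w[symmetric] *[symmetric] by simp
    then show ?thesis by (rule dvdI)
  next
    case False
    then obtain q s' where q: "s = q * s'" "q \<in> only_vars A" "s' \<in> only_vars A" "s' \<noteq> 0" "q \<noteq> 0"
      "prime_within (insert v A) q" "degree_sum s' < degree_sum s"
      using coefficient_factor less.prems by metis
    have sp0: "s * p \<noteq> 0" using less.prems(2) p0 by simp
    then have cd0: "c \<noteq> 0" "d \<noteq> 0" using less.prems(5) by auto
    have "s * p \<in> only_vars (insert v A)"
      using less.prems(1) p only_vars_mono[of A "insert v A"] by (blast intro: only_vars_arith)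
    then have d: "d \<in> only_vars (insert v A)"
      using only_vars_factor[of c d] sp0 less.prems(5) by simp
    have "c * d = q * (s' * p)" unfolding less.prems(5)[symmetric] q(1) by (simp only: mult.assoc)
    then have "q dvd c * d" by simp
    then have "q dvd c \<or> q dvd d" using q(6) d less.prems(3) unfolding prime_within_def by blast
    then show ?thesis
    proof
      assume "q dvd c"
      then obtain c' where c': "c = q * c'" by blast
      have c'0: "c' \<noteq> 0" using c' cd0 by auto
      have "deg v q = 0" using q(2) v by (simp add: only_vars_def)
      then have "deg v c' > 0" using less.prems(4) deg_mult[OF q(5) c'0, of v] unfolding c' by simp
      moreover have "c' \<in> only_vars (insert v A)"
        using only_vars_factor[of q c'] less.prems(3) cd0(1) unfolding c' by simp
      moreover have "s' * p = c' * d"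
        using less.prems(5) q(5) unfolding q(1) c' by (simp add: mult.assoc)
      ultimately have "p dvd c'" using less.hyps[OF q(7,3,4)] by blast
      then show ?thesis unfolding c' by simp
    next
      assume "q dvd d"
      then obtain d' where d': "d = q * d'" by blast
      have "q * (s' * p) = q * (c * d')"
        using less.prems(5) unfolding q(1) d' by (simp add: mult_ac)
      then have "s' * p = c * d'" using q(5) by simp
      then show ?thesis using less.hyps[OF q(7,3,4) less.prems(3,4)] by blast
    qed
  qed
qed

text \<open>
  In the ideal generated by $p$ and $f$ take a nonzero $c$ of least degree in $x_v$.  By
  pseudo-division, $c$ divides both $p$ and $f$ up to factors free of $v$.  If $c$ involves $v$, then
  $p$ divides $c$ and hence $f$.  Otherwise $c = a p + b f$ gives $p \mid c g$, hence $p \mid g$.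
\<close>

lemma prime_within_step: "prime_within (insert v A) p"
  unfolding prime_within_def
proof (intro ballI impI)
  let ?B = "only_vars (insert v A) :: ('a, 'v) mpoly set"
  have AB: "only_vars A \<subseteq> ?B" by (rule only_vars_mono) auto
  have p0: "p \<noteq> 0" using dp by auto
  have B01: "0 \<in> ?B" "1 \<in> ?B" by (auto simp: only_vars_def)
  fix f g assume f: "f \<in> ?B" and g: "g \<in> ?B" and fg: "p dvd f * g"
  define I where "I = {a * p + b * f | a b. a \<in> ?B \<and> b \<in> ?B}"
  have I: "a * p + b * f \<in> I" if "a \<in> ?B" "b \<in> ?B" for a b using that by (auto simp: I_def)
  have pI: "p \<in> I" and fI: "f \<in> I" using I[of 1 0] I[of 0 1] B01 by simp_all
  have IB: "I \<subseteq> ?B" unfolding I_def using p f by (auto intro!: only_vars_arith)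
  have closed: "s * x - y * q \<in> I" if xy: "x \<in> I" "y \<in> I" and sq: "s \<in> ?B" "q \<in> ?B" for x y s q
  proof -
    obtain a b a' b' where *: "x = a * p + b * f" "y = a' * p + b' * f" "a \<in> ?B" "b \<in> ?B" "a' \<in> ?B" "b' \<in> ?B"
      using xy by (auto simp: I_def)
    have "s * x - y * q = (s * a - a' * q) * p + (s * b - b' * q) * f" by (simp add: * algebra_simps)
    moreover have "s * a - a' * q \<in> ?B" "s * b - b' * q \<in> ?B" using * sq by (auto intro!: only_vars_arith)
    ultimately show ?thesis unfolding I_def by blast
  qed
  let ?P = "\<lambda>x. x \<in> I \<and> x \<noteq> 0"
  define c where "c = arg_min (deg v) ?P"
  have "?P c \<and> (\<forall>x. ?P x \<longrightarrow> deg v c \<le> deg v x)"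
    unfolding c_def by (rule arg_min_nat_lemma[of ?P p]) (use pI p0 in simp)
  then have c: "c \<in> I" "c \<noteq> 0" and min: "\<And>x. x \<in> I \<Longrightarrow> x \<noteq> 0 \<Longrightarrow> deg v c \<le> deg v x"
    by simp_all
  have cB: "c \<in> ?B" using c IB by blast
  have multiple: "\<exists>s q. s \<in> only_vars A \<and> s \<noteq> 0 \<and> s * x = c * q" if x: "x \<in> I" for x
  proof -
    obtain s q r where *: "s \<in> only_vars A" "s \<noteq> 0" "q \<in> ?B" "s * x = c * q + r" "r = 0 \<or> deg v r < deg v c"
      using pseudo_division[OF cB c(2) _ v, of x] x IB by blast
    have "r = s * x - c * q" using * by simp
    then have "r \<in> I" using closed[OF x c(1), of s q] * AB by blast
    then have "r = 0" using min[of r] *(5) by (metis not_le)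
    then show ?thesis using * by auto
  qed
  show "p dvd f \<or> p dvd g"
  proof (cases "deg v c = 0")
    case True
    then have cA: "c \<in> only_vars A" using only_vars_insertD[OF cB] by blast
    obtain a b where "c = a * p + b * f" using c by (auto simp: I_def)
    then have "c * g = p * (a * g) + b * (f * g)" by (simp add: algebra_simps)
    then have "p dvd c * g" using fg by simp
    then show ?thesis using cancel_coefficient[OF cA c(2) g] by blast
  next
    case False
    obtain s q where "s \<in> only_vars A" "s \<noteq> 0" "s * p = c * q" using multiple[OF pI] by blast
    then have pc: "p dvd c" using dvd_of_coefficient_multiple[OF _ _ cB] False by blast
    obtain s q where s: "s \<in> only_vars A" "s \<noteq> 0" "s * f = c * q" using multiple[OF fI] by blast
    then have "p dvd s * f" using pc by simp
    then show ?thesis using cancel_coefficient[OF s(1,2) f] by blast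
  qed
qed

end

lemma irreducible_prime_within:
  fixes p :: "('a::field, 'v::{finite,linorder}) mpoly"
  assumes "finite A" "p \<in> only_vars A" "irreducible p"
  shows "prime_within A p"
  using assms
proof (induction A arbitrary: p rule: finite_induct)
  case empty
  then have "p dvd 1" by (subst dvd_1_iff_deg) (auto simp: only_vars_def irreducible_def)
  then show ?case using empty by (simp add: irreducible_def)
next
  case (insert v A)
  show ?case
  proof (cases "deg v p = 0")
    case True
    then have "p \<in> only_vars A" using insert.prems only_vars_insertD by blast
    then show ?thesis using insert prime_within_insert by blast
  next
    case False
    then show ?thesis using prime_within_step[OF insert.hyps(2) insert.IH insert.prems] by simp
  qed
qed

theorem irreducible_mpoly_prime:
  fixes p :: "('a::field, 'v::{finite,linorder}) mpoly"
  assumes "irreducible p" shows "prime_elem p"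
proof (rule prime_elemI)
  show "p \<noteq> 0" "\<not> p dvd 1" using assms by (auto simp: irreducible_def)
  fix f g assume "p dvd f * g"
  moreover have "prime_within UNIV p" by (rule irreducible_prime_within) (auto simp: assms only_vars_def)
  ultimately show "p dvd f \<or> p dvd g" by (auto simp: prime_within_def only_vars_def)
qed

section \<open>Partial derivatives and poles along a prime\<close>

lemma lookup_D_x_mpoly:
  "lk (D_x_mpoly v p) e = of_nat (Suc (lk e v)) * lk p (e + single v 1)"
proof (induction p rule: poly_mapping_single_induct)
  case 1
  show ?case by (simp add: derivation_0[OF derivation_D_x_mpoly])
next
  case (2 k c q)
  have "lk (D_x_mpoly v (single k c)) e = of_nat (Suc (lk e v)) * lk (single k c) (e + single v 1)"
  proof (cases "k = e + single v 1")
    case True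
    then show ?thesis by (simp add: D_x_mpoly_single lookup_add)
  next
    case False
    have "e = k - single v 1 \<Longrightarrow> lk k v = 0"
    proof (rule ccontr)
      assume "e = k - single v 1" "lk k v \<noteq> 0"
      then have "k = e + single v 1"
        by (intro poly_mapping_eqI) (auto simp: lookup_add lookup_minus lookup_single when_def)
      then show False using False by simp
    qed
    then show ?thesis using False by (auto simp: D_x_mpoly_single lookup_single when_def)
  qed
  then show ?case using 2 by (simp add: D_x_mpoly_add lookup_add distrib_left del: of_nat_Suc)
qed

lemma expand_D_x_mpoly: "expand v (D_x_mpoly v p) = pderiv (expand v p)"
proof (induction p rule: poly_mapping_single_induct)
  case 1
  show ?case by (simp add: derivation_0[OF derivation_D_x_mpoly])
next
  case (2 k c q)
  have "Poly_Mapping.update v 0 (k - single v 1) = Poly_Mapping.update v 0 k"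
    by (rule poly_mapping_eqI) (simp add: lookup_update lookup_minus lookup_single when_def)
  moreover have "single e (of_nat n * c) = of_nat n * single e c" for e n
    by (metis add_0 mult_single single_of_nat)
  ultimately have "expand v (D_x_mpoly v (single k c)) = pderiv (expand v (single k c))"
    by (simp add: D_x_mpoly_single expand_single lookup_minus pderiv_monom)
  then show ?case using 2 by (simp add: D_x_mpoly_add expand_add pderiv_add)
qed

lemma deg_D_x_mpoly_le: "deg w (D_x_mpoly v p) \<le> deg w p"
  unfolding deg_le_iff
proof (intro allI impI)
  fix e assume "lk (D_x_mpoly v p) e \<noteq> 0"
  then have "lk p (e + single v 1) \<noteq> 0" by (auto simp: lookup_D_x_mpoly)
  then have "lk (e + single v 1) w \<le> deg w p" using deg_le_iff[of w p "deg w p"] by blast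
  then show "lk e w \<le> deg w p" by (simp add: lookup_add)
qed

text \<open>
  A prime is not constant, so in characteristic zero some partial derivative is nonzero; its degree
  in that variable is too small for it to be a multiple of $p$.
\<close>

lemma prime_not_dvd_derivative:
  fixes p :: "('k::field_char_0, 'v::{finite,linorder}) kt_mpoly"
  assumes "prime_elem p"
  obtains v where "\<not> p dvd D_x_mpoly v p"
proof -
  have p: "p \<noteq> 0" "\<not> p dvd 1" using assms by (auto simp: prime_elem_def)
  then obtain v where v: "deg v p \<noteq> 0" using dvd_1_iff_deg[OF p(1)] by blast
  then have ne: "D_x_mpoly v p \<noteq> 0"
    using expand_D_x_mpoly[of v p] by (auto simp: deg_def pderiv_eq_0_iff)
  have "deg v (D_x_mpoly v p) = deg v p - 1"
    by (simp add: deg_def expand_D_x_mpoly degree_pderiv)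
  then have "\<not> p dvd D_x_mpoly v p" using deg_dvd[OF _ ne, of p v] v by auto
  then show ?thesis by (rule that)
qed

text \<open>
  The localization of the ring at the prime $p$: the fractions without a pole along $p$.
\<close>

definition local_ring :: "'a::idom \<Rightarrow> 'a fract set" where
  "local_ring p = {Fract a b | a b. \<not> p dvd b}"

lemma local_ringI: "\<not> p dvd b \<Longrightarrow> Fract a b \<in> local_ring p"
  by (auto simp: local_ring_def)

context
  fixes p :: "'a::idom"
  assumes p: "prime_elem p"
begin

lemma local_ring_Fract_1: "Fract a 1 \<in> local_ring p"
  using p by (intro local_ringI) (simp add: prime_elem_def)

lemma local_ring_arith:
  assumes "f \<in> local_ring p" "g \<in> local_ring p"
  shows "f + g \<in> local_ring p" "f - g \<in> local_ring p" "f * g \<in> local_ring p"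
proof -
  obtain a b c d where *: "f = Fract a b" "g = Fract c d" "\<not> p dvd b" "\<not> p dvd d"
    using assms by (auto simp: local_ring_def)
  then have "b \<noteq> 0" "d \<noteq> 0" "\<not> p dvd b * d" using prime_elem_dvd_multD[OF p] by auto
  then show "f + g \<in> local_ring p" "f - g \<in> local_ring p" "f * g \<in> local_ring p"
    using * by (auto intro: local_ringI)
qed

lemma local_ring_deriv:
  assumes d: "derivation d" and f: "f \<in> local_ring p"
  shows "fract_deriv d f \<in> local_ring p"
proof -
  obtain a b where *: "f = Fract a b" "\<not> p dvd b" using f by (auto simp: local_ring_def)
  then have "b \<noteq> 0" "\<not> p dvd b * b" using prime_elem_dvd_multD[OF p] by auto
  then show ?thesis unfolding * by (simp add: fract_deriv_Fract[OF d] local_ringI)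
qed

lemma local_ring_cancel:
  assumes "\<not> p dvd x" "Fract x 1 * f \<in> local_ring p"
  shows "f \<in> local_ring p"
proof -
  have "x \<noteq> 0" using assms by auto
  then have "f = Fract 1 x * (Fract x 1 * f)"
    by (cases f) (auto simp: eq_fract)
  then show ?thesis using assms local_ring_arith(3) local_ringI by metis
qed

end

lemma exists_pole_order:
  fixes p b :: "('a::field, 'v::{finite,linorder}) mpoly"
  assumes p: "prime_elem p" and b: "b \<noteq> 0"
  obtains n b' where "b = p ^ n * b'" "\<not> p dvd b'"
proof -
  have "\<exists>n b'. b = p ^ n * b' \<and> \<not> p dvd b'" using b
  proof (induction "degree_sum b" arbitrary: b rule: less_induct)
    case less
    show ?case
    proof (cases "p dvd b")
      case True
      then obtain c where c: "b = p * c" by blast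
      then have "c \<noteq> 0" "p \<noteq> 0" using less.prems by auto
      then have "degree_sum c < degree_sum b"
        using degree_sum_pos[of p] p c by (simp add: degree_sum_mult prime_elem_def)
      then obtain n b' where "c = p ^ n * b'" "\<not> p dvd b'" using less.hyps \<open>c \<noteq> 0\<close> by blast
      then have "b = p ^ Suc n * b' \<and> \<not> p dvd b'" using c by (simp add: mult.assoc)
      then show ?thesis by blast
    next
      case False
      then show ?thesis by (intro exI[of _ 0] exI[of _ b]) simp
    qed
  qed
  then show ?thesis using that by blast
qed

text \<open>
  If $f$ has a pole of order $n > 0$ along $p$, then the derivative of $f$ has one of order $n + 1$.
  Valuations are avoided as follows: with $n$ least such that $p^n f$ is regular, the product rule
  writes $n\,p^{n-1} (dp) f$ as $d(p^n f) - p^n df$, which is regular if $p\,df$ is; and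
  $n$ and $dp$ are units of the local ring, so $p^{n-1} f$ would be regular.
\<close>

lemma pole_of_derivative:
  fixes p :: "('k::field_char_0, 'v::{finite,linorder}) kt_mpoly"
  assumes p: "prime_elem p" and d: "derivation d" and dp: "\<not> p dvd d p"
    and df: "Fract p 1 * fract_deriv d f \<in> local_ring p"
  shows "f \<in> local_ring p"
proof (rule ccontr)
  assume f: "f \<notin> local_ring p"
  let ?P = "Fract p 1" and ?D = "fract_deriv d"
  note D = derivation_fract_deriv[OF d]
  have DP: "?D ?P = Fract (d p) 1"
    by (simp add: fract_deriv_Fract[OF d] derivation_1[OF d])
  have "\<exists>n. ?P ^ n * f \<in> local_ring p"
  proof -
    obtain a b where ab: "f = Fract a b" "b \<noteq> 0" by (cases f) auto
    obtain n b' where b': "b = p ^ n * b'" "\<not> p dvd b'" by (rule exists_pole_order[OF p ab(2)])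
    have "?P ^ m = Fract (p ^ m) 1" for m by (induction m) (simp_all add: One_fract_def)
    then have "?P ^ n * f = Fract a b'" using ab b' by (auto simp: eq_fract)
    then show ?thesis using b' local_ringI by metis
  qed
  define n where "n = (LEAST n. ?P ^ n * f \<in> local_ring p)"
  have n: "?P ^ n * f \<in> local_ring p"
    unfolding n_def by (rule LeastI_ex) fact
  obtain m where m: "n = Suc m" using n f by (cases n) auto
  have "?P ^ m * f \<notin> local_ring p"
    using not_less_Least[of m "\<lambda>n. ?P ^ n * f \<in> local_ring p"] m by (simp add: n_def)
  moreover have "?P ^ m * f \<in> local_ring p"
  proof -
    have pow: "?D (?P ^ Suc k) = of_nat (Suc k) * ?P ^ k * ?D ?P" for k
      by (induction k) (simp_all add: derivationD[OF D] algebra_simps)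
    have Pm: "?P ^ k \<in> local_ring p" for k
      by (induction k) (auto simp: local_ring_Fract_1[OF p] One_fract_def intro: local_ring_arith[OF p])
    have 1: "?D (?P ^ n * f) \<in> local_ring p" by (rule local_ring_deriv[OF p d n])
    have 2: "?P ^ m * (?P * ?D f) \<in> local_ring p" by (intro local_ring_arith[OF p] Pm df)
    have "?D (?P ^ n * f) = of_nat n * ?P ^ m * ?D ?P * f + ?P ^ m * (?P * ?D f)"
      unfolding m derivationD(2)[OF D] pow by (simp add: algebra_simps)
    then have "of_nat n * ?P ^ m * ?D ?P * f \<in> local_ring p"
      using local_ring_arith(2)[OF p 1 2] by simp
    moreover have "of_nat n * ?P ^ m * ?D ?P * f = Fract (d p) 1 * (Fract (of_nat n) 1 * (?P ^ m * f))"
      by (simp add: DP of_nat_fract mult_ac)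
    ultimately have "Fract (of_nat n) 1 * (?P ^ m * f) \<in> local_ring p"
      using local_ring_cancel[OF p dp] by metis
    moreover have "\<not> p dvd of_nat n"
    proof
      assume "p dvd of_nat n"
      moreover have "(of_nat n :: ('k, 'v) kt_mpoly) dvd 1"
      proof (subst dvd_1_iff_deg)
        show "of_nat n \<noteq> (0 :: ('k, 'v) kt_mpoly)" by (simp add: m del: of_nat_Suc)
        show "\<forall>v. deg v (of_nat n :: ('k, 'v) kt_mpoly) = 0" by (metis deg_single_0 single_of_nat)
      qed
      ultimately show False using p by (meson dvd_trans prime_elem_def)
    qed
    ultimately show ?thesis using local_ring_cancel[OF p] by blast
  qed
  ultimately show False by simp
qed

text \<open>
  In a representation $a/b$ with \<open>degree_sum b\<close> least, no irreducible divides both $a$ and $b$.  An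
  irreducible divisor $p$ of $b$, being prime, would then be a pole.
\<close>

lemma polynomial_if_no_poles:
  fixes f :: "('a::field, 'v::{finite,linorder}) mpoly fract"
  assumes f: "\<And>p. prime_elem p \<Longrightarrow> f \<in> local_ring p"
  obtains a where "f = Fract a 1"
proof -
  let ?P = "\<lambda>b. b \<noteq> 0 \<and> (\<exists>a. f = Fract a b)"
  define b where "b = arg_min degree_sum ?P"
  obtain b0 where "?P b0" by (cases f) auto
  then have "?P b \<and> (\<forall>c. ?P c \<longrightarrow> degree_sum b \<le> degree_sum c)"
    unfolding b_def by (rule arg_min_nat_lemma)
  then obtain a where b: "b \<noteq> 0" "f = Fract a b" and min: "\<And>c. ?P c \<Longrightarrow> degree_sum b \<le> degree_sum c"
    by blast
  have "b dvd 1"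
  proof (rule ccontr)
    assume "\<not> b dvd 1"
    then obtain p where p: "irreducible p" "p dvd b" using exists_irreducible_factor b by blast
    then have prime: "prime_elem p" by (intro irreducible_mpoly_prime)
    obtain b' where b': "b = p * b'" using p by blast
    obtain c d where cd: "f = Fract c d" "\<not> p dvd d" using f[OF prime] by (auto simp: local_ring_def)
    then have "d \<noteq> 0" by auto
    then have "a * d = c * b" using cd b by (simp add: eq_fract)
    then have "p dvd a * d" using b' by simp
    then have "p dvd a" using prime_elem_dvd_multD[OF prime] cd by blast
    then obtain a' where a': "a = p * a'" by blast
    have nz: "p \<noteq> 0" "b' \<noteq> 0" using b b' by auto
    then have "f = Fract a' b'" using b a' b' by (simp add: eq_fract)
    then have "degree_sum b \<le> degree_sum b'" using min[of b'] nz by blast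
    moreover have "degree_sum p > 0" using degree_sum_pos[of p] nz prime by (simp add: prime_elem_def)
    ultimately show False using b' nz by (simp add: degree_sum_mult)
  qed
  then obtain u where u: "1 = b * u" by (rule dvdE)
  have "f = Fract (a * u) 1" using b u by (simp add: eq_fract mult_ac)
  then show ?thesis by (rule that)
qed

section \<open>Proper rational functions\<close>

text \<open>
  As the degree of a fraction does not depend on its representation (\<open>proper_Fract_iff\<close>), the
  fraction need not be in lowest terms.  This makes closure under addition immediate.
\<close>

definition proper :: "'v \<Rightarrow> ('a::field, 'v::linorder) mpoly fract \<Rightarrow> bool" where
  "proper v f \<longleftrightarrow> (\<exists>a b. b \<noteq> 0 \<and> f = Fract a b \<and> (a = 0 \<or> deg v a < deg v b))"

lemma proper_Fract_iff:
  assumes "b \<noteq> 0"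
  shows "proper v (Fract a b) \<longleftrightarrow> a = 0 \<or> deg v a < deg v b"
proof
  assume "proper v (Fract a b)"
  then obtain c d where *: "d \<noteq> 0" "Fract a b = Fract c d" "c = 0 \<or> deg v c < deg v d"
    by (auto simp: proper_def)
  then have eq: "a * d = c * b" using assms by (simp add: eq_fract)
  show "a = 0 \<or> deg v a < deg v b"
  proof (rule disjCI)
    assume "\<not> deg v a < deg v b"
    show "a = 0"
    proof (rule ccontr)
      assume a: "a \<noteq> 0"
      then have c: "c \<noteq> 0" using eq * by auto
      have "deg v a + deg v d = deg v c + deg v b"
        using deg_mult[OF a *(1), of v] deg_mult[OF c assms, of v] eq by simp
      then show False using * c \<open>\<not> deg v a < deg v b\<close> by simp
    qed
  qed
qed (use assms in \<open>auto simp: proper_def\<close>)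

lemma proper_add:
  assumes "proper v f" "proper v g"
  shows "proper v (f + g)"
proof -
  obtain a b c d where *: "b \<noteq> 0" "f = Fract a b" "a = 0 \<or> deg v a < deg v b"
      "d \<noteq> 0" "g = Fract c d" "c = 0 \<or> deg v c < deg v d"
    using assms by (auto simp: proper_def)
  show ?thesis
  proof (cases "a = 0 \<or> c = 0")
    case True
    then have "f = 0 \<or> g = 0" using * by (auto simp: fract_collapse)
    then show ?thesis using assms by auto
  next
    case False
    have fg: "f + g = Fract (a * d + c * b) (b * d)" using * by simp
    have lt: "deg v a < deg v b" "deg v c < deg v d" using * False by auto
    have "deg v (a * d + c * b) \<le> deg v b + deg v d - 1"
      using lt deg_mult_le[of v a d] deg_mult_le[of v c b] by (intro deg_add_le) linarith+
    also have "\<dots> < deg v (b * d)" using deg_mult[OF *(1,4), of v] lt by simp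
    finally show ?thesis unfolding fg using * by (subst proper_Fract_iff) auto
  qed
qed

lemma proper_polynomial: "proper v (Fract a 1) \<Longrightarrow> a = 0"
  by (simp add: proper_Fract_iff)

lemma proper_0: "proper v 0"
  unfolding Zero_fract_def by (subst proper_Fract_iff) simp_all

lemma proper_of_kt:
  assumes "proper v f" shows "proper v (of_kt c * f)"
proof -
  obtain a b where *: "b \<noteq> 0" "f = Fract a b" "a = 0 \<or> deg v a < deg v b"
    using assms by (auto simp: proper_def)
  have "of_kt c * f = Fract (single 0 c * a) b" using * by (simp add: of_kt_def)
  moreover have "deg v (single 0 c * a) \<le> deg v a" using deg_mult_le[of v "single 0 c" a] by simp
  ultimately show ?thesis using * by (auto simp: proper_Fract_iff)
qed

lemma proper_D_x:
  assumes "proper v f" shows "proper v (D_x w f)"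
proof -
  obtain a b where *: "b \<noteq> 0" "f = Fract a b" "a = 0 \<or> deg v a < deg v b"
    using assms by (auto simp: proper_def)
  show ?thesis
  proof (cases "a = 0")
    case True
    then have "f = 0" using * by (simp add: fract_collapse)
    then show ?thesis by (simp add: proper_0 derivation_0[OF derivation_D_x])
  next
    case False
    have D: "D_x w f = Fract (D_x_mpoly w a * b - a * D_x_mpoly w b) (b * b)"
      unfolding D_x_def * by (rule fract_deriv_Fract[OF derivation_D_x_mpoly *(1)])
    have "deg v (D_x_mpoly w a * b - a * D_x_mpoly w b) \<le> deg v a + deg v b"
      using deg_mult_le[of v "D_x_mpoly w a" b] deg_mult_le[of v a "D_x_mpoly w b"]
        deg_D_x_mpoly_le[of v w a] deg_D_x_mpoly_le[of v w b]
      by (intro deg_diff_le) linarith+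
    also have "\<dots> < deg v (b * b)" using * False by (simp add: deg_mult)
    finally show ?thesis unfolding D using * by (subst proper_Fract_iff) auto
  qed
qed

text \<open>
  This is the numerator of the derivative of $P/Q$.  The leading terms of its two products carry the
  factors $\deg P$ and $\deg Q$, so they do not cancel.
\<close>

lemma coeff_wronskian:
  fixes P Q :: "'a::{idom,ring_char_0} poly"
  assumes "degree P > degree Q"
  shows "coeff (pderiv P * Q - P * pderiv Q) (degree P + degree Q - 1) =
    (of_nat (degree P) - of_nat (degree Q)) * lead_coeff P * lead_coeff Q"
proof -
  let ?n = "degree P + degree Q - 1"
  have 1: "coeff (pderiv P * Q) ?n = of_nat (degree P) * lead_coeff P * lead_coeff Q"
    using coeff_mult_degree_sum[of "pderiv P" Q] assms by (simp add: degree_pderiv coeff_pderiv)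
  have 2: "coeff (P * pderiv Q) ?n = of_nat (degree Q) * lead_coeff P * lead_coeff Q"
  proof (cases "degree Q = 0")
    case True
    then have "pderiv Q = 0" by (simp add: pderiv_eq_0_iff)
    then show ?thesis using True by simp
  next
    case False
    then show ?thesis
      using coeff_mult_degree_sum[of P "pderiv Q"] by (simp add: degree_pderiv coeff_pderiv mult_ac)
  qed
  show ?thesis unfolding coeff_diff 1 2 by (simp only: left_diff_distrib)
qed

text \<open>
  Differentiation lowers a positive degree by exactly one, so the derivative of a fraction of
  positive degree has nonnegative degree.
\<close>

lemma degree_le_if_derivative_proper:
  fixes a b :: "('k::field_char_0, 'v::linorder) kt_mpoly"
  assumes b: "b \<noteq> 0" and pr: "proper v (D_x v (Fract a b))"
  shows "deg v a \<le> deg v b"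
proof (rule ccontr)
  assume "\<not> deg v a \<le> deg v b"
  then have gt: "degree (expand v a) > degree (expand v b)" by (simp add: deg_def)
  then have a: "a \<noteq> 0" by auto
  let ?N = "D_x_mpoly v a * b - a * D_x_mpoly v b"
  let ?n = "degree (expand v a) + degree (expand v b) - 1"
  have uN: "expand v ?N = pderiv (expand v a) * expand v b - expand v a * pderiv (expand v b)"
    by (simp add: expand_diff expand_mult expand_D_x_mpoly)
  have "coeff (expand v ?N) ?n \<noteq> 0"
    unfolding uN coeff_wronskian[OF gt] using gt a b by simp
  then have "?n \<le> deg v ?N" "?N \<noteq> 0" unfolding deg_def by (auto intro: le_degree)
  moreover have "deg v (b * b) \<le> ?n" using gt deg_mult[OF b b, of v] unfolding deg_def by linarith
  moreover have "D_x v (Fract a b) = Fract ?N (b * b)"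
    unfolding D_x_def by (rule fract_deriv_Fract[OF derivation_D_x_mpoly b])
  ultimately show False using pr b by (simp add: proper_Fract_iff)
qed

section \<open>Reduced forms\<close>

text \<open>
  Unlike simplicity, this property is visibly linear: it does not mention a reduced denominator.
\<close>

definition reduced_form :: "('k::field_char_0, 'v::linorder) one_form \<Rightarrow> bool" where
  "reduced_form h \<longleftrightarrow>
     (\<forall>i. proper i (h i) \<and> (\<forall>p. prime_elem p \<longrightarrow> Fract p 1 * h i \<in> local_ring p))"

text \<open>
  A squarefree denominator contains each prime at most once.
\<close>

lemma simple_form_reduced:
  fixes h :: "('k::field_char_0, 'v::linorder) one_form"
  assumes "simple_form h" shows "reduced_form h"
  unfolding reduced_form_def
proof (intro allI conjI impI)
  fix i
  have "proper_in i (h i)" using assms by (simp add: simple_form_def)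
  then obtain a b where "b \<noteq> 0" "h i = Fract a b" "a = 0 \<or> deg_in i a < deg_in i b"
    by (auto simp: proper_in_def lowest_terms_def)
  then show "proper i (h i)" unfolding proper_def using deg_in_eq by metis
  fix p :: "('k, 'v) kt_mpoly" assume p: "prime_elem p"
  have "squarefree_denom (h i)" using assms by (simp add: simple_form_def)
  then obtain a b where ab: "b \<noteq> 0" "h i = Fract a b" "squarefree b"
    by (auto simp: squarefree_denom_def lowest_terms_def)
  show "Fract p 1 * h i \<in> local_ring p"
  proof (cases "p dvd b")
    case True
    then obtain b' where b': "b = p * b'" by blast
    have "\<not> p dvd b'"
    proof
      assume "p dvd b'"
      then have "p ^ 2 dvd b" using b' by (auto simp: power2_eq_square)
      then show False using ab p by (auto simp: squarefree_def prime_elem_def)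
    qed
    moreover have "Fract p 1 * h i = Fract a b'" using ab b' by (auto simp: eq_fract)
    ultimately show ?thesis by (simp add: local_ringI)
  next
    case False
    then show ?thesis using ab by (simp add: local_ringI)
  qed
qed

lemma reduced_form_lincomb:
  fixes h :: "'j \<Rightarrow> ('k::field_char_0, 'v::linorder) one_form"
  assumes "\<And>j. j \<in> J \<Longrightarrow> reduced_form (h j)"
  shows "reduced_form (\<lambda>i. \<Sum>j\<in>J. of_kt (a j) * h j i)"
  unfolding reduced_form_def
proof (intro allI conjI impI)
  fix i
  show "proper i (\<Sum>j\<in>J. of_kt (a j) * h j i)"
    using assms by (induction J rule: infinite_finite_induct)
      (auto simp: proper_0 reduced_form_def intro!: proper_add proper_of_kt)
  fix p :: "('k, 'v) kt_mpoly" assume p: "prime_elem p"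
  have "(\<Sum>j\<in>J. of_kt (a j) * (Fract p 1 * h j i)) \<in> local_ring p"
    using assms
  proof (induction J rule: infinite_finite_induct)
    case (insert j J)
    then have "Fract p 1 * h j i \<in> local_ring p" using p by (auto simp: reduced_form_def)
    then show ?case
      using insert by (auto simp: of_kt_def intro!: local_ring_arith[OF p] local_ring_Fract_1[OF p])
  qed (use local_ring_Fract_1[OF p, of 0] in \<open>simp_all add: fract_collapse\<close>)
  then show "Fract p 1 * (\<Sum>j\<in>J. of_kt (a j) * h j i) \<in> local_ring p"
    by (simp add: sum_distrib_left mult_ac)
qed

text \<open>
  For $\eta = 0$ this says that primitives of reduced forms have no poles.  For $\eta$ regular along
  $p$ it says that the reduction $\eta = dg + h$ creates no poles along $p$.
\<close>

lemma primitive_regular: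
  fixes h :: "('k::field_char_0, 'v::{finite,linorder}) one_form"
  assumes h: "reduced_form h" and p: "prime_elem p"
    and eta: "\<And>i. \<eta> i \<in> local_ring p" and eq: "\<And>i. \<eta> i = D_x i g + h i"
  shows "g \<in> local_ring p"
proof -
  obtain v where v: "\<not> p dvd D_x_mpoly v p" by (rule prime_not_dvd_derivative[OF p])
  \<comment> \<open>A pole of $g$ would produce at least a double pole of $\partial_v g$, but $h_v$ has at most a simple one.\<close>
  have "Fract p 1 * D_x v g = Fract p 1 * \<eta> v - Fract p 1 * h v"
    by (simp add: eq distrib_left)
  also have "\<dots> \<in> local_ring p"
    using h p eta local_ring_arith(3)[OF p local_ring_Fract_1[OF p] eta]
    by (intro local_ring_arith(2)[OF p]) (auto simp: reduced_form_def)
  finally show ?thesis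
    unfolding D_x_def by (rule pole_of_derivative[OF p derivation_D_x_mpoly v])
qed

lemma reduced_exact_zero:
  fixes h :: "('k::field_char_0, 'v::{finite,linorder}) one_form"
  assumes h: "reduced_form h" and eq: "\<And>i. h i = D_x i g"
  shows "h i = 0"
proof -
  have "- g \<in> local_ring p" if p: "prime_elem p" for p
  proof (rule primitive_regular[OF h p])
    show "(0 :: ('k, 'v) ratfun) \<in> local_ring p"
      using local_ring_Fract_1[OF p, of 0] by (simp add: fract_collapse)
    show "0 = D_x i (- g) + h i" for i by (simp add: eq derivation_minus[OF derivation_D_x])
  qed
  then obtain a where a: "- g = Fract a 1" by (rule polynomial_if_no_poles)
  have "h i = - D_x i (- g)" by (simp add: eq derivation_minus[OF derivation_D_x])
  also have "\<dots> = Fract (- D_x_mpoly i a) 1" by (simp add: a D_x_Fract_1)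
  finally have "h i = Fract (- D_x_mpoly i a) 1" .
  moreover from this have "- D_x_mpoly i a = 0"
    using h proper_polynomial unfolding reduced_form_def by metis
  ultimately show ?thesis by (simp add: fract_collapse)
qed

text \<open>
  Along primes dividing $D$, the factor $D$ clears the simple pole of $h_i$.  The degree bound in the
  variables $x_j$ with $j \neq i$ comes from $\partial_j h_i = \partial_i h_j$, which is proper in
  $x_j$ because $h_j$ is.
\<close>

lemma reduced_form_bounded:
  fixes h :: "('k::field_char_0, 'v::{finite,linorder}) one_form"
  assumes h: "reduced_form h" and closed: "closed_form h" and D: "D \<noteq> 0"
    and reg: "\<And>p i. prime_elem p \<Longrightarrow> \<not> p dvd D \<Longrightarrow> h i \<in> local_ring p"
  obtains q where "Fract D 1 * h i = Fract q 1" "\<And>j. deg j q \<le> deg j D"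
proof -
  have "Fract D 1 * h i \<in> local_ring p" if p: "prime_elem p" for p
  proof (cases "p dvd D")
    case True
    then obtain D' where "D = p * D'" by blast
    then have eq: "Fract D 1 * h i = Fract D' 1 * (Fract p 1 * h i)"
      by (simp add: mult_ac flip: mult.assoc)
    show ?thesis
      unfolding eq
      by (rule local_ring_arith(3)[OF p local_ring_Fract_1[OF p]])
        (use h p in \<open>simp add: reduced_form_def\<close>)
  next
    case False
    then show ?thesis using reg p by (intro local_ring_arith[OF p] local_ring_Fract_1[OF p])
  qed
  then obtain q where q: "Fract D 1 * h i = Fract q 1" by (rule polynomial_if_no_poles)
  have "deg j q \<le> deg j D" for j
  proof (cases "q = 0")
    case False
    obtain a b where ab: "h i = Fract a b" "b \<noteq> 0" by (cases "h i") auto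
    have "D_x j (h i) = D_x i (h j)" using closed by (simp add: closed_form_def)
    moreover have "proper j (D_x i (h j))" using h by (simp add: reduced_form_def proper_D_x)
    ultimately have "deg j a \<le> deg j b" using degree_le_if_derivative_proper[OF ab(2)] ab(1) by simp
    moreover have eq: "D * a = q * b" using q ab by (simp add: eq_fract)
    moreover have "a \<noteq> 0" using eq False ab by auto
    ultimately show ?thesis using deg_mult[OF D, of a j] deg_mult[OF False ab(2), of j] by simp
  qed simp
  then show ?thesis using that q by blast
qed

section \<open>Forms with a common denominator and bounded degrees\<close>

text \<open>
  Gaussian elimination: solve one equation for an unknown $l$ that occurs in it, substitute in the
  remaining equations.
\<close>

lemma homogeneous_system:
  fixes c :: "'j \<Rightarrow> 'i \<Rightarrow> 'a::field"
  assumes "finite I" "finite J" "card I < card J"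
  shows "\<exists>x. (\<exists>j\<in>J. x j \<noteq> 0) \<and> (\<forall>i\<in>I. (\<Sum>j\<in>J. x j * c j i) = 0)"
  using assms
proof (induction I arbitrary: J c rule: finite_induct)
  case empty
  then have "J \<noteq> {}" by auto
  then show ?case by (intro exI[of _ "\<lambda>_. 1"]) auto
next
  case (insert k I)
  show ?case
  proof (cases "\<forall>j\<in>J. c j k = 0")
    case True
    have "card I < card J" using insert by simp
    then obtain x where "\<exists>j\<in>J. x j \<noteq> 0" "\<forall>i\<in>I. (\<Sum>j\<in>J. x j * c j i) = 0"
      using insert.IH[of J c] insert.prems by blast
    then show ?thesis using True by (intro exI[of _ x]) auto
  next
    case False
    then obtain l where l: "l \<in> J" "c l k \<noteq> 0" by blast
    define J' where "J' = J - {l}"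
    have J': "finite J'" "l \<notin> J'" "J = insert l J'" "card I < card J'"
      using insert l by (auto simp: J'_def)
    obtain x where x: "\<exists>j\<in>J'. x j \<noteq> 0"
      "\<forall>i\<in>I. (\<Sum>j\<in>J'. x j * (c j i - c j k / c l k * c l i)) = 0"
      using insert.IH[OF J'(1,4), of "\<lambda>j i. c j i - c j k / c l k * c l i"] by blast
    define y where "y = - (\<Sum>j\<in>J'. x j * c j k) / c l k"
    have sum: "(\<Sum>j\<in>J. (x(l := y)) j * c j i) = y * c l i + (\<Sum>j\<in>J'. x j * c j i)" for i
    proof -
      have "(\<Sum>j\<in>J'. (x(l := y)) j * c j i) = (\<Sum>j\<in>J'. x j * c j i)"
        using J'(2) by (intro sum.cong) auto
      then show ?thesis using J' by simp
    qed
    have "(\<Sum>j\<in>J. (x(l := y)) j * c j i) = (\<Sum>j\<in>J'. x j * (c j i - c j k / c l k * c l i))" for i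
      unfolding sum
      by (simp add: y_def right_diff_distrib sum_subtractf sum_distrib_left sum_distrib_right
          sum_divide_distrib mult_ac)
    moreover have "(\<Sum>j\<in>J'. x j * (c j k - c j k / c l k * c l k)) = 0" using l by simp
    ultimately have "\<forall>i\<in>insert k I. (\<Sum>j\<in>J. (x(l := y)) j * c j i) = 0"
      using x(2) by (metis insertE)
    moreover have "\<exists>j\<in>J. (x(l := y)) j \<noteq> 0" using x(1) J' by auto
    ultimately show ?thesis by blast
  qed
qed

lemma finite_bounded_exponents:
  "finite {e :: 'v::finite \<Rightarrow>\<^sub>0 nat. \<forall>v. lk e v \<le> N v}"
proof -
  have "finite (lk ` {e :: 'v \<Rightarrow>\<^sub>0 nat. \<forall>v. lk e v \<le> N v})"
    by (rule finite_subset[OF _ finite_PiE[of UNIV "\<lambda>v. {..N v}"]]) auto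
  moreover have "inj_on lk {e :: 'v \<Rightarrow>\<^sub>0 nat. \<forall>v. lk e v \<le> N v}"
    by (rule inj_onI) (simp add: poly_mapping_eqI)
  ultimately show ?thesis by (rule finite_imageD)
qed

lemma lookup_of_kt_mult: "lk (single 0 c * q) e = c * lk q e"
  by (induction q rule: poly_mapping_single_induct)
    (simp_all add: distrib_left lookup_add mult_single lookup_single when_def)

text \<open>
  The coefficients of the $q_{n,i}$ are coordinates of the $n$-th form, and the degree bound leaves
  finitely many exponents.
\<close>

lemma bounded_forms_dependent:
  fixes r :: "nat \<Rightarrow> ('k::field_char_0, 'v::{finite,linorder}) one_form"
  assumes D: "D \<noteq> 0"
    and q: "\<And>n i. Fract D 1 * r n i = Fract (q n i) 1" "\<And>n i j. deg j (q n i) \<le> deg j D"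
  obtains n x where "\<exists>j<n. x j \<noteq> 0" "\<And>i. (\<Sum>j<n. of_kt (x j) * r j i) = 0"
proof -
  let ?E = "{e :: 'v \<Rightarrow>\<^sub>0 nat. \<forall>v. lk e v \<le> deg v D}"
  let ?I = "(UNIV :: 'v set) \<times> ?E"
  have "finite ?I" by (intro finite_cartesian_product) (simp_all add: finite_bounded_exponents)
  define n where "n = Suc (card ?I)"
  have "card ?I < card {..<n}" by (simp add: n_def)
  then obtain x where x: "\<exists>j\<in>{..<n}. x j \<noteq> 0"
    "\<forall>k\<in>?I. (\<Sum>j<n. x j * lk (q j (fst k)) (snd k)) = 0"
    using homogeneous_system[OF \<open>finite ?I\<close> finite_lessThan,
        of n "\<lambda>j k. lk (q j (fst k)) (snd k)"] by blast
  have "(\<Sum>j<n. of_kt (x j) * r j i) = 0" for i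
  proof -
    have "(\<Sum>j<n. single 0 (x j) * q j i) = 0"
    proof (rule poly_mapping_eqI)
      fix e
      show "lk (\<Sum>j<n. single 0 (x j) * q j i) e = lk 0 e"
      proof (cases "e \<in> ?E")
        case True
        then have "(\<Sum>j<n. x j * lk (q j i) e) = 0"
          using x(2)[rule_format, of "(i, e)"] by simp
        then show ?thesis by (simp add: lookup_sum lookup_of_kt_mult)
      next
        case False
        then obtain v where v: "\<not> lk e v \<le> deg v D" by auto
        have "lk (q j i) e = 0" for j
          using deg_le_iff[of v "q j i" "deg v D"] q(2)[of v j i] v by auto
        then show ?thesis by (simp add: lookup_sum lookup_of_kt_mult)
      qed
    qed
    then have "Fract (\<Sum>j<n. single 0 (x j) * q j i) 1 = 0" by (simp add: fract_collapse)
    moreover have "Fract (sum f A) 1 = (\<Sum>j\<in>A. Fract (f j) 1)" for f :: "nat \<Rightarrow> ('k, 'v) kt_mpoly" and A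
    proof (induction A rule: infinite_finite_induct)
      case (insert a A)
      then have "(\<Sum>j\<in>insert a A. Fract (f j) 1) = Fract (f a) 1 + Fract (sum f A) 1" by simp
      also have "\<dots> = Fract (f a + sum f A) 1" by simp
      finally show ?case using insert.hyps by simp
    qed (simp_all add: fract_collapse)
    moreover have "Fract (single 0 (x j) * q j i) 1 = Fract D 1 * (of_kt (x j) * r j i)" for j
    proof -
      have "Fract (single 0 (x j) * q j i) 1 = of_kt (x j) * Fract (q j i) 1" by (simp add: of_kt_def)
      then show ?thesis by (simp add: mult_ac flip: q(1))
    qed
    ultimately have "Fract D 1 * (\<Sum>j<n. of_kt (x j) * r j i) = 0"
      by (simp add: sum_distrib_left)
    moreover have "Fract D 1 \<noteq> 0" using D by (simp add: Zero_fract_def eq_fract)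
    ultimately show ?thesis by simp
  qed
  then show ?thesis using that[of n x] x(1) by auto
qed

section \<open>The reduced remainders and the algorithm\<close>

text \<open>
  The commutator of two derivations is a derivation.  It vanishes on the ring, hence on fractions.
\<close>

lemma fract_deriv_commute:
  assumes d: "derivation d" and e: "derivation e" and comm: "\<And>a. d (e a) = e (d a)"
  shows "fract_deriv d (fract_deriv e f) = fract_deriv e (fract_deriv d f)"
proof -
  let ?d = "fract_deriv d" and ?e = "fract_deriv e"
  note D = derivation_fract_deriv[OF d] derivation_fract_deriv[OF e]
  let ?c = "\<lambda>f. ?d (?e f) - ?e (?d f)"
  have prod: "?c (f * h) = ?c f * h + f * ?c h" for f h
    by (simp add: derivationD[OF D(1)] derivationD[OF D(2)] algebra_simps)
  have base: "?c (Fract a 1) = 0" for a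
    by (simp add: fract_deriv_Fract[OF d] fract_deriv_Fract[OF e] derivation_1[OF d]
        derivation_1[OF e] comm)
  obtain a b where f: "f = Fract a b" "b \<noteq> 0" by (cases f) auto
  then have "f * Fract b 1 = Fract a 1" by (simp add: eq_fract)
  then have "?c f * Fract b 1 = 0" using prod[of f "Fract b 1"] base[of a] base[of b] by simp
  moreover have "Fract b 1 \<noteq> 0" using f by (simp add: Zero_fract_def eq_fract)
  ultimately show ?thesis by simp
qed

lemma D_t_D_x: "D_t (D_x v f) = D_x v (D_t f)"
  unfolding D_t_def D_x_def
proof (rule fract_deriv_commute[OF derivation_D_t_mpoly derivation_D_x_mpoly], rule poly_mapping_eqI)
  fix p and e :: "'a \<Rightarrow>\<^sub>0 nat"
  note \<delta> = derivation_deriv_kt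
  show "lk (D_t_mpoly (D_x_mpoly v p)) e = lk (D_x_mpoly v (D_t_mpoly p)) e"
    by (simp only: D_t_mpoly_lookup lookup_D_x_mpoly derivationD(2)[OF \<delta>] derivation_of_nat[OF \<delta>]
        mult_zero_left add_0)
qed

lemma closed_form_D_t: "closed_form f \<Longrightarrow> closed_form (\<lambda>i. D_t (f i))"
  unfolding closed_form_def by (simp flip: D_t_D_x)

lemma D_x_of_kt_mult: "D_x i (of_kt c * f) = of_kt c * D_x i f"
  by (simp add: derivationD(2)[OF derivation_D_x] D_x_of_kt)

text \<open>
  The sequence of pairs $(g_n, r_n)$ that the loop would produce if it never stopped.
\<close>

fun reduction :: "(('k::field_char_0, 'v::linorder) one_form \<Rightarrow> ('k, 'v) ratfun \<times> ('k, 'v) one_form) \<Rightarrow>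
    ('k, 'v) one_form \<Rightarrow> nat \<Rightarrow> ('k, 'v) ratfun \<times> ('k, 'v) one_form" where
  "reduction H f 0 = H f"
| "reduction H f (Suc n) = H (\<lambda>i. D_t (snd (reduction H f n) i))"

context
  fixes H :: "('k::field_char_0, 'v::{finite,linorder}) one_form \<Rightarrow> ('k, 'v) ratfun \<times> ('k, 'v) one_form"
    and \<omega> :: "('k, 'v) one_form"
  assumes H: "hermite_one_form H" and closed: "closed_form \<omega>"
begin

abbreviation "cert n \<equiv> fst (reduction H \<omega> n)"
abbreviation "rem n \<equiv> snd (reduction H \<omega> n)"

lemma hermite:
  assumes "closed_form f"
  shows "simple_form (snd (H f))" "f i = D_x i (fst (H f)) + snd (H f) i"
  using H assms unfolding hermite_one_form_def by (auto simp: case_prod_beta)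

lemma simple_rem: "simple_form (rem n)"
  and closed_rem: "closed_form (rem n)"
proof -
  show "simple_form (rem n)"
  proof (induction n)
    case (Suc n)
    then have "closed_form (\<lambda>i. D_t (rem n i))" by (intro closed_form_D_t) (simp add: simple_form_def)
    then show ?case using hermite(1) by simp
  qed (simp add: hermite(1)[OF closed])
  then show "closed_form (rem n)" by (simp add: simple_form_def)
qed

lemma rem_0: "\<omega> i = D_x i (cert 0) + rem 0 i"
  using hermite(2)[OF closed] by simp

lemma rem_Suc: "D_t (rem n i) = D_x i (cert (Suc n)) + rem (Suc n) i"
  using hermite(2)[OF closed_form_D_t[OF closed_rem[of n]], of i] by simp

lemma reduced_rem: "reduced_form (rem n)"
  by (rule simple_form_reduced[OF simple_rem])

lemma D_t_power:
  "(D_t ^^ n) (\<omega> i) = D_x i (\<Sum>j\<le>n. (D_t ^^ (n - j)) (cert j)) + rem n i"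
proof (induction n)
  case 0
  show ?case using rem_0[of i] by (simp del: reduction.simps)
next
  case (Suc n)
  have "(D_t ^^ Suc n) (\<omega> i) = D_x i (D_t (\<Sum>j\<le>n. (D_t ^^ (n - j)) (cert j)))
      + (D_x i (cert (Suc n)) + rem (Suc n) i)"
    using Suc by (simp add: derivationD(1)[OF derivation_D_t] D_t_D_x rem_Suc del: reduction.simps)
  also have "D_t (\<Sum>j\<le>n. (D_t ^^ (n - j)) (cert j)) = (\<Sum>j\<le>n. (D_t ^^ (Suc n - j)) (cert j))"
    unfolding derivation_sum[OF derivation_D_t] by (intro sum.cong) (simp_all add: Suc_diff_le)
  finally show ?case
    by (simp add: derivationD(1)[OF derivation_D_x] add.assoc del: reduction.simps)
qed

lemma operator_reduction:
  "(\<Sum>n\<le>N. of_kt (a n) * (D_t ^^ n) (\<omega> i)) =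
     D_x i (\<Sum>n\<le>N. of_kt (a n) * (\<Sum>j\<le>n. (D_t ^^ (n - j)) (cert j)))
     + (\<Sum>n\<le>N. of_kt (a n) * rem n i)"
  unfolding D_t_power distrib_left sum.distrib derivation_sum[OF derivation_D_x] D_x_of_kt_mult ..

text \<open>
  The step from $r_n$ to $r_{n+1}$ differentiates by $t$, which keeps the local ring, and subtracts
  $dg_{n+1}$, where $g_{n+1}$ is regular by \<open>primitive_regular\<close>.
\<close>

lemma rem_regular:
  assumes p: "prime_elem p" and 0: "\<And>i. rem 0 i \<in> local_ring p"
  shows "rem n i \<in> local_ring p"
proof (induction n arbitrary: i)
  case 0
  show ?case by (rule assms(2))
next
  case (Suc n)
  have *: "D_t (rem n i) \<in> local_ring p" for i
    unfolding D_t_def by (rule local_ring_deriv[OF p derivation_D_t_mpoly Suc])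
  have "cert (Suc n) \<in> local_ring p"
    by (rule primitive_regular[OF reduced_rem p, of "\<lambda>i. D_t (rem n i)" _ "Suc n"])
      (rule *, rule rem_Suc)
  then have "D_x i (cert (Suc n)) \<in> local_ring p"
    unfolding D_x_def by (rule local_ring_deriv[OF p derivation_D_x_mpoly])
  moreover have "rem (Suc n) i = D_t (rem n i) - D_x i (cert (Suc n))"
    by (simp only: rem_Suc add_diff_cancel_left')
  ultimately show ?case using local_ring_arith(2)[OF p *[of i]] by metis
qed

lemma remainders_dependent:
  obtains n x where "\<exists>j<n. x j \<noteq> 0" "\<And>i. (\<Sum>j<n. of_kt (x j) * rem j i) = 0"
proof -
  have "\<exists>b. b \<noteq> 0 \<and> (\<exists>a. rem 0 i = Fract a b)" for i by (cases "rem 0 i") auto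
  then obtain b where b: "\<And>i. b i \<noteq> 0" "\<And>i. \<exists>a. rem 0 i = Fract a (b i)" by metis
  define D where "D = (\<Prod>i\<in>UNIV. b i)"
  have D: "D \<noteq> 0" using b(1) by (simp add: D_def)
  have reg: "rem n i \<in> local_ring p" if p: "prime_elem p" "\<not> p dvd D" for p n i
  proof (rule rem_regular[OF p(1)])
    fix i
    have "b i dvd D" unfolding D_def by (rule dvd_prodI) auto
    then have "\<not> p dvd b i" using p(2) dvd_trans by blast
    then show "rem 0 i \<in> local_ring p" using b(2)[of i] by (auto intro: local_ringI)
  qed
  have "\<exists>q. Fract D 1 * rem n i = Fract q 1 \<and> (\<forall>j. deg j q \<le> deg j D)" for n i
    using reduced_form_bounded[OF reduced_rem closed_rem D reg, of n i] by metis
  then obtain q where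
    q: "\<And>n i. Fract D 1 * rem n i = Fract (q n i) 1" "\<And>n i j. deg j (q n i) \<le> deg j D"
    by metis
  obtain n x where "\<exists>j<n. x j \<noteq> 0" "\<And>i. (\<Sum>j<n. of_kt (x j) * rem j i) = 0"
    by (rule bounded_forms_dependent[of D "\<lambda>n. rem n", OF D q]) blast
  then show ?thesis by (rule that)
qed

abbreviation "rems n \<equiv> map rem [0..<n]"

lemma lin_relation_rems:
  "lin_relation a (rems n) \<longleftrightarrow> (\<forall>i. (\<Sum>j<n. of_kt (a j) * rem j i) = 0)"
  by (simp add: lin_relation_def)

text \<open>
  The coefficients of any telescoper form a linear relation among the remainders, because the
  combination of remainders that they define is reduced and exact.
\<close>

lemma telescoper_degree:
  assumes L: "L \<noteq> 0" "telescoper L \<omega>"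
  shows "\<not> lin_indep (rems (Suc (degree L)))"
proof -
  obtain g where g: "\<And>i. ac_deriv (D_x i) g = to_ac (op_apply L (\<omega> i))"
    using L by (auto simp: telescoper_def certificate_def)
  have "\<exists>g'. \<forall>i. op_apply L (\<omega> i) = D_x i g'"
    by (rule algebraic_primitive_descends[of D_x, OF derivation_D_x g])
  then obtain g' where g': "\<And>i. op_apply L (\<omega> i) = D_x i g'" by blast
  let ?h = "\<lambda>i. \<Sum>n\<le>degree L. of_kt (coeff L n) * rem n i"
  have "?h i = 0" for i
  proof (rule reduced_exact_zero)
    show "reduced_form ?h" by (rule reduced_form_lincomb[OF reduced_rem])
    fix i
    show "?h i = D_x i (g' - (\<Sum>n\<le>degree L. of_kt (coeff L n) * (\<Sum>j\<le>n. (D_t ^^ (n - j)) (cert j))))"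
      using g'[of i] unfolding op_apply_def operator_reduction derivation_diff[OF derivation_D_x]
      by (simp add: algebra_simps)
  qed
  then have "lin_relation (coeff L) (rems (Suc (degree L)))"
    unfolding lin_relation_rems lessThan_Suc_atMost by blast
  moreover have "coeff L (degree L) \<noteq> 0" using L(1) by simp
  moreover have "degree L < length (rems (Suc (degree L)))" by simp
  ultimately show ?thesis unfolding lin_indep_def by blast
qed

text \<open>
  After $k$ iterations the state consists of the first $k+1$ pairs; the loop stops at the first
  linear dependency, which exists by \<open>remainders_dependent\<close>.
\<close>

lemma ct_one_form_eq:
  defines "n \<equiv> LEAST n. \<not> lin_indep (rems (Suc n))"
  shows "ct_one_form H rel \<omega> = (let a = rel (rems (Suc n)) in
     Some (\<Sum>i\<le>n. monom (a i) i, \<Sum>i\<le>n. of_kt (a i) * (\<Sum>j\<le>i. (D_t ^^ (i - j)) (cert j))))"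
    and "\<not> lin_indep (rems (Suc n))"
    and "\<And>m. m < n \<Longrightarrow> lin_indep (rems (Suc m))"
proof -
  let ?b = "\<lambda>(n, G, R). lin_indep R"
  let ?c = "\<lambda>(n, G, R). let n' = n + 1; (g, r) = H (\<lambda>i. D_t ((R ! (n' - 1)) i))
                in (n', G @ [g], R @ [r])"
  let ?s = "(0 :: nat, [cert 0], [rem 0])"
  have iter: "(?c ^^ k) ?s = (k, map cert [0..<Suc k], rems (Suc k))" for k
    by (induction k) (simp_all add: case_prod_beta Let_def nth_append del: upt_Suc add: upt_Suc_append)
  obtain m x where m: "\<exists>j<m. x j \<noteq> 0" "\<And>i. (\<Sum>j<m. of_kt (x j) * rem j i) = 0"
    by (rule remainders_dependent) blast
  then have "\<not> lin_indep (rems m)" unfolding lin_indep_def lin_relation_rems by auto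
  moreover obtain m' where "m = Suc m'" using m by (cases m) auto
  ultimately have ex: "\<exists>n. \<not> lin_indep (rems (Suc n))" by blast
  then show "\<not> lin_indep (rems (Suc n))" unfolding n_def by (rule LeastI_ex)
  show "\<And>m. m < n \<Longrightarrow> lin_indep (rems (Suc m))" unfolding n_def using not_less_Least by blast
  have b: "?b ((?c ^^ k) ?s) = lin_indep (rems (Suc k))" for k unfolding iter by simp
  have "while_option ?b ?c ?s = Some ((?c ^^ n) ?s)"
    unfolding while_option_def b n_def using ex by simp
  then have w: "while_option ?b ?c ?s = Some (n, map cert [0..<Suc n], rems (Suc n))" unfolding iter .
  have nth: "map cert [0..<Suc n] ! j = cert j" if "j \<le> n" for j
    using that by (simp del: upt_Suc)
  show "ct_one_form H rel \<omega> = (let a = rel (rems (Suc n)) in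
     Some (\<Sum>i\<le>n. monom (a i) i, \<Sum>i\<le>n. of_kt (a i) * (\<Sum>j\<le>i. (D_t ^^ (i - j)) (cert j))))"
  proof -
    have "(\<Sum>j\<le>i. (D_t ^^ (i - j)) (map cert [0..<Suc n] ! j)) = (\<Sum>j\<le>i. (D_t ^^ (i - j)) (cert j))"
      if "i \<le> n" for i using nth that by (intro sum.cong) simp_all
    then show ?thesis
      using w unfolding ct_one_form_def by (simp add: case_prod_beta Let_def del: upt_Suc)
  qed
qed

end

theorem mainTheorem4:
  fixes \<omega> :: "('k::field_char_0, 'v::{finite,linorder}) one_form"
    and H :: "('k, 'v) one_form \<Rightarrow> ('k, 'v) ratfun \<times> ('k, 'v) one_form"
    and rel :: "('k, 'v) one_form list \<Rightarrow> nat \<Rightarrow> 'k kt"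
  assumes "closed_form \<omega>"
    and "hermite_one_form H"
    and "relation_finder rel"
  shows "\<exists>L g. ct_one_form H rel \<omega> = Some (L, g) \<and>
           minimal_telescoper L \<omega> \<and> certificate (to_ac g) L \<omega>"
proof -
  note ctx = assms(2,1)
  let ?r = "\<lambda>n. snd (reduction H \<omega> n)" and ?g = "\<lambda>n. fst (reduction H \<omega> n)"
  define n where "n = (LEAST n. \<not> lin_indep (map ?r [0..<Suc n]))"
  define a where "a = rel (map ?r [0..<Suc n])"
  define L where "L = (\<Sum>i\<le>n. monom (a i) i)"
  define g where "g = (\<Sum>i\<le>n. of_kt (a i) * (\<Sum>j\<le>i. (D_t ^^ (i - j)) (?g j)))"
  have result: "ct_one_form H rel \<omega> = Some (L, g)"
    unfolding ct_one_form_eq(1)[OF ctx] by (simp add: L_def g_def a_def n_def Let_def)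
  have dep: "\<not> lin_indep (map ?r [0..<Suc n])" and
    indep: "\<And>m. m < n \<Longrightarrow> lin_indep (map ?r [0..<Suc m])"
    unfolding n_def by (rule ct_one_form_eq[OF ctx])+
  have rel: "lin_relation a (map ?r [0..<Suc n])"
    and "\<exists>j<length (map ?r [0..<Suc n]). a j \<noteq> 0"
    using assms(3) dep unfolding relation_finder_def a_def by blast+
  then have nz: "\<exists>j\<le>n. a j \<noteq> 0" by (simp add: less_Suc_eq_le del: upt_Suc)
  have coeff: "coeff L i = (if i \<le> n then a i else 0)" for i
    by (auto simp: L_def coeff_sum coeff_monom)
  have L0: "L \<noteq> 0" using nz coeff by (metis coeff_0)
  have deg: "degree L \<le> n" by (rule degree_le) (simp add: coeff)
  have cert: "certificate (to_ac g) L \<omega>"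
    unfolding certificate_def ac_deriv(2)[OF derivation_D_x] to_ac_eq_iff
  proof
    fix i
    have "op_apply L (\<omega> i) = (\<Sum>k\<le>n. of_kt (coeff L k) * (D_t ^^ k) (\<omega> i))"
      unfolding op_apply_def
      by (rule sum.mono_neutral_left) (use deg in \<open>auto simp: coeff_eq_0 of_kt_def fract_collapse\<close>)
    also have "\<dots> = (\<Sum>k\<le>n. of_kt (a k) * (D_t ^^ k) (\<omega> i))" by (simp add: coeff)
    also have "\<dots> = D_x i g + (\<Sum>k\<le>n. of_kt (a k) * ?r k i)"
      unfolding operator_reduction[OF ctx] g_def ..
    also have "(\<Sum>k\<le>n. of_kt (a k) * ?r k i) = 0"
      using rel unfolding lin_relation_rems[OF ctx] lessThan_Suc_atMost by blast
    finally show "op_apply L (\<omega> i) = D_x i g" by simp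
  qed
  have "degree L \<le> degree L'" if "L' \<noteq> 0" "telescoper L' \<omega>" for L'
    using telescoper_degree[OF ctx that] indep[of "degree L'"] deg by force
  then have "minimal_telescoper L \<omega>"
    using L0 cert by (auto simp: minimal_telescoper_def telescoper_def)
  then show ?thesis using result cert by blast
qed

end
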